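(* For all $n\ge1$ and all symmetric $F\in\mathcal{C}^\infty_c((0,\infty)^n,\mathbb{R})$, the function $f(z_1,\ldots,z_n)=F(|z_1|,\ldots,|z_n|)$ on $\mathbb{C}^n$ satisfies $$\operatorname{Ent}_{\mu_n}(f^2)\le\mathcal{E}_{\mu_n}(f,f).$$ Moreover, this inequality remains valid for every $f$ in the $H^1_{\mathbb{R}}(\mu_n)$-closure of the set of such smooth symmetric radial functions.
   Context: $\mu_n$ is the probability measure $\mathrm{d}\mu_n(z)=\frac1{c_n}\mathrm{e}^{-n\sum_k|z_k|^2}\prod_{j<k}|z_j-z_k|^2\,\mathrm{d}z$ on $\mathbb{C}^n\equiv\mathbb{R}^{2n}$ ($c_n$ normalizing constant). Symmetric means invariant under permutations of the $n$ variables. $\mathcal{E}_{\mu_n}(f,f)=\frac1n\int_{\mathbb{C}^n}|\nabla f|^2\,\mathrm{d}\mu_n$ with the Euclidean gradient on $\mathbb{R}^{2n}$, and, with the convention $0\log0=0$, $\operatorname{Ent}_{\mu_n}(f^2)=\int f^2\log(f^2)\,\mathrm{d}\mu_n-\bigl(\int f^2\,\mathrm{d}\mu_n\bigr)\log\int f^2\,\mathrm{d}\mu_n$. $H^1_{\mathbb{R}}(\mu_n)$ is the completion of the space $\mathcal{C}^\infty_c(\mathbb{C}^n,\mathbb{R})$ of real-valued smooth compactly supported functions for the norm $(\|f\|^2_{L^2(\mu_n)}+\|\nabla f\|^2_{L^2(\mu_n)})^{1/2}$, identified with the domain in $L^2(\mu_n)$ of the closure of $\nabla$; $\nabla f$ for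 $f\in H^1_{\mathbb{R}}(\mu_n)$ is understood accordingly. *)

theory Defs
  imports "HOL-Analysis.Analysis"
begin

text \<open>
  Dimensions are carried by an index type \<open>'n\<close>, so that \<open>n = CARD('n) \<ge> 1\<close>; its linear order only
  serves to write products over \<open>j < k\<close>. The space of $n$ complex variables is \<open>complex ^ 'n\<close>, whose
  real inner product, norm and Lebesgue measure \<open>lborel\<close> are those of $\mathbf{R}^{2n}$.
\<close>

subsection \<open>Smooth functions with compact support\<close>

text \<open>
  For open \<open>U\<close>, \<open>Ck_on k U f\<close> says that \<open>f\<close> is of class $C^k$ on \<open>U\<close>: all its iterated directional
  derivatives up to order \<open>k\<close> exist and are continuous on \<open>U\<close>.
\<close>

primrec Ck_on :: "nat \<Rightarrow> 'a::euclidean_space set \<Rightarrow> ('a \<Rightarrow> real) \<Rightarrow> bool" where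
  "Ck_on 0 U f \<longleftrightarrow> continuous_on U f"
| "Ck_on (Suc k) U f \<longleftrightarrow>
     (\<forall>x\<in>U. f differentiable at x) \<and> (\<forall>v. Ck_on k U (\<lambda>x. frechet_derivative f (at x) v))"

definition smooth_on :: "'a::euclidean_space set \<Rightarrow> ('a \<Rightarrow> real) \<Rightarrow> bool" where
  "smooth_on U f \<longleftrightarrow> (\<forall>k. Ck_on k U f)"

text \<open>Elements of $C^\infty_c(U)$ are regarded as functions on the whole space, extended by zero.\<close>

definition Cc_infty :: "'a::euclidean_space set \<Rightarrow> ('a \<Rightarrow> real) set" where
  "Cc_infty U = {f. smooth_on U f \<and> compact (closure {x. f x \<noteq> 0}) \<and> closure {x. f x \<noteq> 0} \<subseteq> U}"

definition gradient :: "('a::euclidean_space \<Rightarrow> real) \<Rightarrow> 'a \<Rightarrow> 'a" where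
  "gradient f x = (THE D. GDERIV f x :> D)"

subsection \<open>The measure \<open>\<mu>\<^sub>n\<close>, entropy and energy\<close>

text \<open>Unlike \<open>complex ^ 'n\<close>, this notation leaves the sort of \<open>'n\<close> open.\<close>

type_synonym 'n cspace = "(complex, 'n) vec"

definition ginibre_weight :: "'n::{finite,linorder} cspace \<Rightarrow> real" where
  "ginibre_weight z =
     exp (- real CARD('n) * (\<Sum>k\<in>UNIV. (cmod (z $ k))\<^sup>2)) *
     (\<Prod>(j, k)\<in>{(j, k). j < k}. (cmod (z $ j - z $ k))\<^sup>2)"

definition ginibre :: "('n::{finite,linorder} cspace) measure" where
  "ginibre = density lborel
     (\<lambda>z. ennreal (ginibre_weight z / (\<integral>w. ginibre_weight (w :: 'n cspace) \<partial>lborel)))"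

text \<open>The convention $0 \log 0 = 0$ is built in.\<close>

definition Ent :: "'a measure \<Rightarrow> ('a \<Rightarrow> real) \<Rightarrow> real" where
  "Ent M h = (\<integral>x. h x * ln (h x) \<partial>M) - (\<integral>x. h x \<partial>M) * ln (\<integral>x. h x \<partial>M)"

text \<open>The energy \<open>\<E>(f, f)\<close>, as a function of the gradient \<open>g\<close> of \<open>f\<close>.\<close>

definition energy :: "('n::{finite,linorder} cspace \<Rightarrow> 'n cspace) \<Rightarrow> real" where
  "energy g = 1 / real CARD('n) * (\<integral>z. (norm (g z))\<^sup>2 \<partial>ginibre)"

subsection \<open>The Sobolev space\<close>

definition square_integrable :: "'a measure \<Rightarrow> ('a \<Rightarrow> 'b::euclidean_space) \<Rightarrow> bool" where
  "square_integrable M f \<longleftrightarrow> f \<in> borel_measurable M \<and> integrable M (\<lambda>x. (norm (f x))\<^sup>2)"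

text \<open>
  The space $H^1$ is the closure in \<open>L\<^sup>2 \<times> L\<^sup>2\<close> of the graph of \<open>\<nabla>\<close> on smooth compactly supported
  functions, i.e. the completion of these functions for \<open>H1_norm f (gradient f)\<close> and at the same time
  the graph of the closure of \<open>\<nabla>\<close>. Its elements are therefore pairs \<open>(f, g)\<close> (of representatives of
  classes modulo null sets), where \<open>g\<close> is the gradient \<open>\<nabla>f\<close> of \<open>f\<close> in the $H^1$ sense.
\<close>

definition H1_norm :: "('n::{finite,linorder} cspace \<Rightarrow> real) \<Rightarrow> ('n cspace \<Rightarrow> 'n cspace) \<Rightarrow> real" where
  "H1_norm f g = sqrt ((\<integral>z. (f z)\<^sup>2 \<partial>ginibre) + (\<integral>z. (norm (g z))\<^sup>2 \<partial>ginibre))"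

definition H1_tendsto ::
  "(nat \<Rightarrow> 'n::{finite,linorder} cspace \<Rightarrow> real) \<Rightarrow>
    ('n cspace \<Rightarrow> real) \<Rightarrow> ('n cspace \<Rightarrow> 'n cspace) \<Rightarrow> bool" where
  "H1_tendsto u f g \<longleftrightarrow>
     (\<lambda>k. H1_norm (\<lambda>z. u k z - f z) (\<lambda>z. gradient (u k) z - g z)) \<longlonglongrightarrow> 0"

definition H1 ::
  "(('n::{finite,linorder} cspace \<Rightarrow> real) \<times> ('n cspace \<Rightarrow> 'n cspace)) set" where
  "H1 = {(f, g). square_integrable ginibre f \<and> square_integrable ginibre g \<and>
     (\<exists>u. (\<forall>k. u k \<in> Cc_infty UNIV) \<and> H1_tendsto u f g)}"

definition H1_closure ::
  "('n::{finite,linorder} cspace \<Rightarrow> real) set \<Rightarrow>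
    (('n cspace \<Rightarrow> real) \<times> ('n cspace \<Rightarrow> 'n cspace)) set" where
  "H1_closure A = {(f, g) \<in> H1. \<exists>u. (\<forall>k. u k \<in> A) \<and> H1_tendsto u f g}"

subsection \<open>Symmetric radial functions\<close>

definition symmetric :: "('b ^ 'n \<Rightarrow> real) \<Rightarrow> bool" where
  "symmetric F \<longleftrightarrow> (\<forall>p x. bij p \<longrightarrow> F (\<chi> i. x $ p i) = F x)"

definition radial :: "(real ^ 'n \<Rightarrow> real) \<Rightarrow> complex ^ 'n \<Rightarrow> real" where
  "radial F z = F (\<chi> i. cmod (z $ i))"

definition symmetric_radial :: "('n::{finite,linorder} cspace \<Rightarrow> real) set" where
  "symmetric_radial = radial ` {F \<in> Cc_infty {x. \<forall>i. 0 < x $ i}. symmetric F}"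

end

theory Submission
  imports Defs "HOL-Probability.Probability" "HOL-Real_Asymp.Real_Asymp"
begin

text \<open>
  Expand the Vandermonde product of the weight by Leibniz' formula and integrate out the arguments of
  the $z_k$ for fixed moduli. Monomials with different exponents are orthogonal under rotations, so
  only the diagonal terms survive, and these are the products of $|z_k|^{2\sigma(k)}$ over the
  permutations \<open>\<sigma>\<close>. A symmetric function of the moduli does not see \<open>\<sigma>\<close>, hence it has the same integral
  as if the moduli were independent with densities proportional to $r^{2a+1} e^{-n r^2}$, for
  $a = 0, \dots, n-1$. This is Kostlan's description of the Ginibre moduli (\<open>integral_ginibre_radial\<close>).

  For a symmetric \<open>F\<close> the claim is therefore about a product measure on the half-lines. The potential of
  each factor, $n r^2 - (2a+1) \log r$, has second derivative at least $2n$, because the logarithm only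
  adds convexity. A probability measure on an interval with this convexity satisfies the logarithmic
  Sobolev inequality with constant $2/(2n) = 1/n$; transporting $f^2\,d\nu$ to \<open>\<nu>\<close> by the monotone map
  proves it (\<open>lsi_interval\<close>, \<open>lsi_radial_law\<close>). Entropy is subadditive on products (\<open>Ent_PiM_le\<close>), so the
  constant $1/n$ passes to the product, and $|\nabla f|(z) = |\nabla F|(|z_1|, \dots, |z_n|)$
  (\<open>norm_gradient_radial\<close>) identifies the right-hand side with the energy. The same $1/n$ that the
  convexity provides is the normalisation of the energy.

  Along a sequence that converges in the Sobolev norm, the energies and the $L^2$ norms converge. The
  function $t \log t$ is bounded below, so Fatou's lemma along an almost everywhere convergent
  subsequence bounds the entropy of the limit, and gives at the same time that it is finite
  (\<open>Ent_le_of_L2_limit\<close>).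
\<close>

section \<open>The logarithmic Sobolev inequality on the line, by monotone transport\<close>

text \<open>
  Monotone transport in dimension one. Let $T$ push $h \rho\,dx$, normalised, to $\rho\,dx$, normalised, and
  put \<open>\<theta> = T - id\<close>. The change of variables formula expresses \<open>ln h\<close> through $\rho(x)$, $\rho(T x)$ and
  $T'$; uniform convexity of \<open>- ln \<rho>\<close> and $\ln T' \le T' - 1 = \theta'$ turn this into the pointwise bound of
  $h \rho \ln h$ by $(h\rho\theta)'$ plus a term that completing the square bounds by
  $\rho (h')^2 / (2 c h)$. On a compact interval $T$ fixes both end points, so $(h\rho\theta)'$ integrates to zero and
  no decay has to be discussed. The measure is not normalised, which is where the second summand on
  the left comes from.
\<close>

lemma lsi_interval:
  fixes \<rho> h h' v :: "real \<Rightarrow> real"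
  assumes ab: "a < b" and c: "0 < c"
    and rho_cont: "continuous_on {a..b} \<rho>" and rho_pos: "\<And>x. x \<in> {a..b} \<Longrightarrow> 0 < \<rho> x"
    and rho_deriv: "\<And>x. x \<in> {a<..<b} \<Longrightarrow> (\<rho> has_real_derivative - v x * \<rho> x) (at x)"
    and h_cont: "continuous_on {a..b} h" and h_pos: "\<And>x. x \<in> {a..b} \<Longrightarrow> 0 < h x"
    and h_deriv: "\<And>x. x \<in> {a<..<b} \<Longrightarrow> (h has_real_derivative h' x) (at x)"
    and h'_cont: "continuous_on {a..b} h'"
    and conv: "\<And>x y. x \<in> {a<..<b} \<Longrightarrow> y \<in> {a..b} \<Longrightarrow>
      ln (\<rho> y) \<le> ln (\<rho> x) - v x * (y - x) - c / 2 * (y - x)\<^sup>2"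
  shows "integral {a..b} (\<lambda>x. h x * \<rho> x * ln (h x)) +
      integral {a..b} (\<lambda>x. h x * \<rho> x) * ln (integral {a..b} \<rho> / integral {a..b} (\<lambda>x. h x * \<rho> x))
    \<le> integral {a..b} (\<lambda>x. \<rho> x * (h' x)\<^sup>2 / h x) / (2 * c)"
proof -
  define R where "R x = integral {a..x} \<rho>" for x
  define H where "H x = integral {a..x} (\<lambda>x. h x * \<rho> x)" for x
  have hr_cont: "continuous_on {a..b} (\<lambda>x. h x * \<rho> x)"
    by (intro continuous_intros rho_cont h_cont)
  have primitive: "continuous_on {a..b} (\<lambda>x. integral {a..x} f)"
      "\<And>x. x \<in> {a<..<b} \<Longrightarrow> ((\<lambda>x. integral {a..x} f) has_real_derivative f x) (at x)"
    if "continuous_on {a..b} f" for f :: "real \<Rightarrow> real"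
  proof -
    show "continuous_on {a..b} (\<lambda>x. integral {a..x} f)"
      by (rule indefinite_integral_continuous_1) (simp add: integrable_continuous_real that)
    fix x assume x: "x \<in> {a<..<b}"
    have "((\<lambda>x. integral {a..x} f) has_real_derivative f x) (at x within {a..b})"
      by (rule integral_has_real_derivative) (use x that in auto)
    then show "((\<lambda>x. integral {a..x} f) has_real_derivative f x) (at x)"
      using x at_within_interior[of x "{a..b}"] by (simp add: interior_atLeastAtMost_real)
  qed
  have R_cont: "continuous_on {a..b} R" and R_deriv: "\<And>x. x \<in> {a<..<b} \<Longrightarrow> (R has_real_derivative \<rho> x) (at x)"
    using primitive[OF rho_cont] unfolding R_def by auto
  have H_cont: "continuous_on {a..b} H" and H_deriv: "\<And>x. x \<in> {a<..<b} \<Longrightarrow> (H has_real_derivative h x * \<rho> x) (at x)"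
    using primitive[OF hr_cont] unfolding H_def by auto
  have incr: "f x < f y"
    if "continuous_on {a..b} f" "\<And>x. x \<in> {a<..<b} \<Longrightarrow> (f has_real_derivative f' x) (at x)"
      "\<And>x. x \<in> {a<..<b} \<Longrightarrow> 0 < f' x" "a \<le> x" "x < y" "y \<le> b" for f f' :: "real \<Rightarrow> real" and x y
  proof (rule DERIV_pos_imp_increasing_open[OF \<open>x < y\<close>])
    show "continuous_on {x..y} f" using that by (auto intro: continuous_on_subset)
    show "\<And>z. x < z \<Longrightarrow> z < y \<Longrightarrow> \<exists>w. DERIV f z :> w \<and> 0 < w"
      using that by (metis (no_types) greaterThanLessThan_iff le_less_trans less_le_trans)
  qed
  have R_mono: "R x < R y" if "a \<le> x" "x < y" "y \<le> b" for x y
    by (rule incr[OF R_cont R_deriv]) (use that rho_pos in auto)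
  have H_mono: "H x < H y" if "a \<le> x" "x < y" "y \<le> b" for x y
    by (rule incr[OF H_cont H_deriv]) (use that rho_pos h_pos in auto)
  have Ra: "R a = 0" and Ha: "H a = 0" by (auto simp: R_def H_def)
  have Rb: "0 < R b" and Hb: "0 < H b" using R_mono[of a b] H_mono[of a b] Ra Ha ab by auto
  define \<kappa> where "\<kappa> = R b / H b"
  have kappa: "0 < \<kappa>" using Rb Hb by (simp add: \<kappa>_def)
  have R_inj: "inj_on R {a..b}"
    by (rule linorder_inj_onI) (use R_mono in force)+
  have R_img: "R ` {a..b} = {0..R b}"
  proof
    have "\<And>x. a \<le> x \<Longrightarrow> x \<le> b \<Longrightarrow> 0 \<le> R x \<and> R x \<le> R b"
      by (metis R_mono Ra order.order_iff_strict order_refl ab)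
    then show "R ` {a..b} \<subseteq> {0..R b}" by auto
    show "{0..R b} \<subseteq> R ` {a..b}"
      using IVT'[of R a _ b] R_cont Ra ab by force
  qed
  define S where "S = inv_into {a..b} R"
  have S_in: "S y \<in> {a..b}" and RS: "R (S y) = y" if "y \<in> {0..R b}" for y
    using that R_img inv_into_into[of y R "{a..b}"] f_inv_into_f[of y R "{a..b}"] by (auto simp: S_def)
  have S_cont: "continuous_on {0..R b} S"
    unfolding R_img[symmetric]
    by (rule continuous_on_inv[OF R_cont]) (auto simp: S_def R_inj)
  have S_deriv: "(S has_real_derivative inverse (\<rho> (S y))) (at y)" and S_in': "S y \<in> {a<..<b}"
    if y: "y \<in> {0<..<R b}" for y
  proof -
    have "S y \<noteq> a" "S y \<noteq> b" using RS[of y] y Ra by auto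
    then show S: "S y \<in> {a<..<b}" using S_in[of y] y by auto
    show "(S has_real_derivative inverse (\<rho> (S y))) (at y)"
    proof (rule DERIV_inverse_function[where a=0 and b="R b" and f=R])
      show "(R has_real_derivative \<rho> (S y)) (at (S y))" using R_deriv S by auto
      show "\<rho> (S y) \<noteq> 0" using rho_pos[of "S y"] S by auto
      show "isCont S y"
        using continuous_on_interior[OF S_cont] y by (simp add: interior_atLeastAtMost_real)
    qed (use y RS in auto)
  qed
  \<comment> \<open>The monotone rearrangement: $R(T x) = \kappa H(x)$ equates the masses to the left of \<open>T x\<close> and \<open>x\<close>,
    and \<open>\<kappa>\<close> makes the total masses equal.\<close>
  define T where "T x = S (\<kappa> * H x)" for x
  have kH: "\<kappa> * H x \<in> {0<..<R b}" if "x \<in> {a<..<b}" for x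
    using H_mono[of a x] H_mono[of x b] Ha that Hb kappa by (auto simp: \<kappa>_def field_simps)
  have kHa: "\<kappa> * H a = 0" "\<kappa> * H b = R b" using Ha Hb by (auto simp: \<kappa>_def)
  have kH': "\<kappa> * H x \<in> {0..R b}" if "x \<in> {a..b}" for x
    using kH[of x] kHa that Rb by (cases "x = a \<or> x = b") (auto simp: less_imp_le)
  have Ta: "T a = a" and Tb: "T b = b"
    using ab kHa Ra R_inj by (auto simp: T_def S_def intro!: inv_into_f_eq)
  have T_cont: "continuous_on {a..b} T"
    unfolding T_def
    by (rule continuous_on_compose2[OF S_cont]) (use kH' in \<open>auto intro!: continuous_intros H_cont\<close>)
  have T_in: "T x \<in> {a<..<b}" if "x \<in> {a<..<b}" for x
    unfolding T_def using S_in' kH[OF that] by auto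
  define T' where "T' x = \<kappa> * (h x * \<rho> x) / \<rho> (T x)" for x
  have T_deriv: "(T has_real_derivative T' x) (at x)" if x: "x \<in> {a<..<b}" for x
  proof -
    have "((\<lambda>x. S (\<kappa> * H x)) has_real_derivative inverse (\<rho> (S (\<kappa> * H x))) * (\<kappa> * (h x * \<rho> x))) (at x)"
      by (rule DERIV_chain'[OF _ S_deriv]) (use x kH in \<open>auto intro!: DERIV_cmult H_deriv\<close>)
    then show ?thesis unfolding T_def T'_def by (simp add: field_simps)
  qed
  define \<Psi> where "\<Psi> x = h x * \<rho> x * ln (\<kappa> * h x) - \<rho> x * (h' x)\<^sup>2 / (2 * c * h x)" for x
  have hnz: "\<And>x. x \<in> {a..b} \<Longrightarrow> h x \<noteq> 0" using h_pos by force
  have Psi_cont: "continuous_on {a..b} \<Psi>"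
    unfolding \<Psi>_def
    by (intro continuous_intros h_cont rho_cont h'_cont) (use hnz kappa c in auto)
  \<comment> \<open>Integration by parts in differential form: the boundary term \<open>h \<rho> \<theta>\<close> minus the integral that has
    to be shown nonpositive. It suffices that \<open>D\<close> is increasing on the open interval.\<close>
  define D where "D x = h x * \<rho> x * (T x - x) - integral {a..x} \<Psi>" for x
  define D' where "D' x = h' x * \<rho> x * (T x - x) - h x * v x * \<rho> x * (T x - x)
      + h x * \<rho> x * (T' x - 1) - \<Psi> x" for x
  have D_cont: "continuous_on {a..b} D"
    unfolding D_def by (intro continuous_intros h_cont rho_cont T_cont primitive(1)[OF Psi_cont])
  have D_deriv: "(D has_real_derivative D' x) (at x)" if x: "x \<in> {a<..<b}" for x
    unfolding D_def D'_def
    by (rule derivative_eq_intros h_deriv[OF x] rho_deriv[OF x] T_deriv[OF x] primitive(2)[OF Psi_cont x] refl)+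
       (simp add: algebra_simps)
  have D'_nonneg: "0 \<le> D' x" if x: "x \<in> {a<..<b}" for x
  proof -
    let ?t = "T x - x"
    have pos: "0 < h x" "0 < \<rho> x" "0 < \<rho> (T x)" using x T_in[OF x] h_pos rho_pos by auto
    have T'pos: "0 < T' x" using pos kappa by (simp add: T'_def)
    have "ln (\<kappa> * h x) = ln (\<rho> (T x)) - ln (\<rho> x) + ln (T' x)"
      using pos kappa by (simp add: T'_def ln_mult ln_div)
    also have "\<dots> \<le> - v x * ?t - c / 2 * ?t\<^sup>2 + (T' x - 1)"
      using conv[OF x, of "T x"] T_in[OF x] ln_le_minus_one[OF T'pos] by auto
    finally have "h x * \<rho> x * ln (\<kappa> * h x) \<le> h x * \<rho> x * (- v x * ?t - c / 2 * ?t\<^sup>2 + (T' x - 1))"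
      using pos by (intro mult_left_mono) auto
    \<comment> \<open>Completing the square in \<open>\<theta>\<close> absorbs the cross term $h' \rho \theta$ into the gain from convexity.\<close>
    moreover have "0 \<le> \<rho> x * (h' x + c * h x * ?t)\<^sup>2 / (2 * c * h x)"
      using pos c by simp
    moreover have "\<rho> x * (h' x + c * h x * ?t)\<^sup>2 / (2 * c * h x)
        = \<rho> x * (h' x)\<^sup>2 / (2 * c * h x) + h' x * \<rho> x * ?t + c / 2 * h x * \<rho> x * ?t\<^sup>2"
      using pos c by (simp add: field_simps power2_eq_square)
    ultimately show ?thesis
      unfolding D'_def \<Psi>_def by (simp add: algebra_simps)
  qed
  have "D a \<le> D b"
  proof (rule DERIV_nonneg_imp_increasing_open[OF less_imp_le[OF ab]])
    show "\<And>x. a < x \<Longrightarrow> x < b \<Longrightarrow> \<exists>y. DERIV D x :> y \<and> 0 \<le> y"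
      using D_deriv D'_nonneg by (metis greaterThanLessThan_iff)
  qed (rule D_cont)
  then have le: "integral {a..b} \<Psi> \<le> 0" by (simp add: D_def Ta Tb)
  have "integral {a..b} \<Psi> = integral {a..b} (\<lambda>x. h x * \<rho> x * ln (h x) + ln \<kappa> * (h x * \<rho> x)
      - \<rho> x * (h' x)\<^sup>2 / h x / (2 * c))"
    by (rule integral_cong) (use h_pos kappa in \<open>auto simp: \<Psi>_def ln_mult algebra_simps\<close>)
  also have "\<dots> = integral {a..b} (\<lambda>x. h x * \<rho> x * ln (h x)) + ln \<kappa> * integral {a..b} (\<lambda>x. h x * \<rho> x)
      - integral {a..b} (\<lambda>x. \<rho> x * (h' x)\<^sup>2 / h x) / (2 * c)"
  proof -
    have 1: "(\<lambda>x. h x * \<rho> x * ln (h x)) integrable_on {a..b}"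
      by (intro integrable_continuous_real continuous_intros h_cont rho_cont) (use hnz in auto)
    have 2: "(\<lambda>x. h x * \<rho> x) integrable_on {a..b}"
      by (intro integrable_continuous_real hr_cont)
    have 3: "(\<lambda>x. \<rho> x * (h' x)\<^sup>2 / h x) integrable_on {a..b}"
      by (intro integrable_continuous_real continuous_intros h_cont rho_cont h'_cont) (use hnz in auto)
    show ?thesis
      by (intro integral_unique has_integral_diff has_integral_add has_integral_mult_right
          has_integral_divide integrable_integral 1 2 3)
  qed
  finally show ?thesis using le by (simp add: \<kappa>_def R_def H_def mult.commute)
qed

text \<open>
  The compact intervals $[1/(k+2), k+2]$ stay away from the possible singularity of the potential at
  the origin and exhaust the half-line.
\<close>

lemma integral_exhaust_tendsto:
  fixes g \<rho> :: "real \<Rightarrow> real"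
  assumes [measurable]: "g \<in> borel_measurable borel" "\<rho> \<in> borel_measurable borel"
    and rho_nonneg: "\<And>x. 0 \<le> \<rho> x" and rho_zero: "\<And>x. x \<le> 0 \<Longrightarrow> \<rho> x = 0"
    and prob: "prob_space (density lborel \<rho>)" and bound: "\<And>x. \<bar>g x\<bar> \<le> B"
  shows "(\<lambda>k. integral {1 / real (k + 2)..real (k + 2)} (\<lambda>x. g x * \<rho> x)) \<longlonglongrightarrow> (\<integral>x. g x \<partial>density lborel \<rho>)"
proof -
  interpret prob_space "density lborel \<rho>" by fact
  have "integrable (density lborel \<rho>) g"
    by (rule integrable_const_bound[of _ B]) (use bound in auto)
  then have int: "integrable lborel (\<lambda>x. g x * \<rho> x)"
    by (subst (asm) integrable_real_density) (use rho_nonneg in \<open>auto simp: mult.commute\<close>)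
  have eq: "integral {a..b} (\<lambda>x. g x * \<rho> x) = (\<integral>x. indicator {a..b} x * (g x * \<rho> x) \<partial>lborel)" for a b
    using set_borel_integral_eq_integral(2)[of "{a..b}" "\<lambda>x. g x * \<rho> x"] int
      integrable_mult_indicator[OF _ int, of "{a..b}"]
    by (simp add: set_integrable_def set_lebesgue_integral_def)
  have "(\<lambda>k. \<integral>x. indicator {1 / real (k + 2)..real (k + 2)} x * (g x * \<rho> x) \<partial>lborel)
      \<longlonglongrightarrow> (\<integral>x. g x * \<rho> x \<partial>lborel)"
  proof (rule integral_dominated_convergence)
    show "integrable lborel (\<lambda>x. \<bar>g x * \<rho> x\<bar>)" using int by simp
    show "AE x in lborel. (\<lambda>k. indicator {1 / real (k + 2)..real (k + 2)} x * (g x * \<rho> x)) \<longlonglongrightarrow> g x * \<rho> x"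
    proof (intro AE_I2)
      fix x :: real
      show "(\<lambda>k. indicator {1 / real (k + 2)..real (k + 2)} x * (g x * \<rho> x)) \<longlonglongrightarrow> g x * \<rho> x"
      proof (cases "x \<le> 0")
        case True then show ?thesis by (simp add: rho_zero)
      next
        case False
        have "(\<lambda>k. 1 / real (k + 2)) \<longlonglongrightarrow> 0"
          using LIMSEQ_ignore_initial_segment[OF lim_1_over_n, of 2] by simp
        then have "eventually (\<lambda>k. 1 / real (k + 2) < x) sequentially"
          using False by (auto intro: order_tendstoD)
        moreover have "eventually (\<lambda>k. x < real (k + 2)) sequentially"
          using filterlim_real_sequentially unfolding filterlim_at_top_dense
          by (rule allE[of _ x]) (erule eventually_mono, simp)
        ultimately have "eventually (\<lambda>k. indicator {1 / real (k + 2)..real (k + 2)} x * (g x * \<rho> x) = g x * \<rho> x) sequentially"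
          by eventually_elim (auto simp: indicator_def)
        then show ?thesis by (rule tendsto_eventually)
      qed
    qed
    show "AE x in lborel. norm (indicator {1 / real (k + 2)..real (k + 2)} x * (g x * \<rho> x)) \<le> \<bar>g x * \<rho> x\<bar>" for k
      by (auto simp: indicator_def abs_mult)
  qed auto
  also have "(\<integral>x. g x * \<rho> x \<partial>lborel) = (\<integral>x. g x \<partial>density lborel \<rho>)"
    by (subst integral_real_density) (use rho_nonneg in \<open>auto simp: mult.commute\<close>)
  finally show ?thesis by (simp only: eq)
qed

text \<open>
  Adding \<open>\<epsilon>\<close> keeps the density positive, as the transport map requires, and does not increase the
  Fisher information beyond that of $f^2$.
\<close>

lemma lsi_halfline:
  fixes f f' \<rho> v :: "real \<Rightarrow> real"
  assumes c: "0 < c" and \<epsilon>: "0 < \<epsilon>"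
    and rho_pos: "\<And>x. 0 < x \<Longrightarrow> 0 < \<rho> x" and rho_zero: "\<And>x. x \<le> 0 \<Longrightarrow> \<rho> x = 0"
    and rho_meas[measurable]: "\<rho> \<in> borel_measurable borel"
    and prob: "prob_space (density lborel \<rho>)"
    and rho_deriv: "\<And>x. 0 < x \<Longrightarrow> (\<rho> has_real_derivative - v x * \<rho> x) (at x)"
    and conv: "\<And>x y. 0 < x \<Longrightarrow> 0 < y \<Longrightarrow> ln (\<rho> y) \<le> ln (\<rho> x) - v x * (y - x) - c / 2 * (y - x)\<^sup>2"
    and f_meas[measurable]: "f \<in> borel_measurable borel" and f'_meas[measurable]: "f' \<in> borel_measurable borel"
    and f_deriv: "\<And>x. 0 < x \<Longrightarrow> (f has_real_derivative f' x) (at x)"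
    and f'_cont: "continuous_on {0<..} f'"
    and f_bound: "\<And>x. \<bar>f x\<bar> \<le> B" and f'_bound: "\<And>x. \<bar>f' x\<bar> \<le> B"
  shows "Ent (density lborel \<rho>) (\<lambda>x. (f x)\<^sup>2 + \<epsilon>) \<le> 2 / c * (\<integral>x. (f' x)\<^sup>2 \<partial>density lborel \<rho>)"
proof -
  let ?\<nu> = "density lborel \<rho>"
  interpret prob_space ?\<nu> by fact
  define h where "h x = (f x)\<^sup>2 + \<epsilon>" for x
  have h_pos: "0 < h x" and h_ge: "\<epsilon> \<le> h x" for x using \<epsilon> by (auto simp: h_def add_nonneg_pos)
  have [measurable]: "h \<in> borel_measurable borel" by (simp add: h_def[abs_def])
  have sq: "(f x)\<^sup>2 \<le> B\<^sup>2" "(f' x)\<^sup>2 \<le> B\<^sup>2" for x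
    using f_bound[of x] f'_bound[of x] by (auto intro: abs_le_square_iff[THEN iffD1])
  have h_le: "h x \<le> B\<^sup>2 + \<epsilon>" for x using sq[of x] by (simp add: h_def)
  have hln: "\<bar>h x * ln (h x)\<bar> \<le> (B\<^sup>2 + \<epsilon>) * (\<bar>ln \<epsilon>\<bar> + \<bar>ln (B\<^sup>2 + \<epsilon>)\<bar>)" for x
  proof -
    have "ln \<epsilon> \<le> ln (h x)" using \<epsilon> h_ge[of x] h_pos[of x] by simp
    moreover have "ln (h x) \<le> ln (B\<^sup>2 + \<epsilon>)" by (rule ln_mono) (use h_pos h_le in auto)
    ultimately have "\<bar>ln (h x)\<bar> \<le> \<bar>ln \<epsilon>\<bar> + \<bar>ln (B\<^sup>2 + \<epsilon>)\<bar>" by linarith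
    then show ?thesis unfolding abs_mult
      using h_pos[of x] h_le[of x] by (intro mult_mono) auto
  qed
  have nonneg: "0 \<le> \<rho> x" for x using rho_pos[of x] rho_zero[of x] by (cases "0 < x") auto
  let ?I = "\<lambda>k g. integral {1 / real (k + 2)..real (k + 2)} (\<lambda>x. g x * \<rho> x)"
  have lim: "(\<lambda>k. ?I k g) \<longlonglongrightarrow> (\<integral>x. g x \<partial>?\<nu>)"
    if "g \<in> borel_measurable borel" "\<And>x. \<bar>g x\<bar> \<le> C" for g C
    by (rule integral_exhaust_tendsto[OF that(1) rho_meas nonneg rho_zero prob that(2)])
  have "(\<lambda>k. ?I k (\<lambda>_. 1)) \<longlonglongrightarrow> (\<integral>x. 1 \<partial>?\<nu>)" by (rule lim[of "\<lambda>_. 1" 1]) auto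
  then have lim0: "(\<lambda>k. ?I k (\<lambda>_. 1)) \<longlonglongrightarrow> 1" using prob_space by simp
  have lim1: "(\<lambda>k. ?I k h) \<longlonglongrightarrow> (\<integral>x. h x \<partial>?\<nu>)"
    by (rule lim[of h "B\<^sup>2 + \<epsilon>"]) (use h_pos h_le in \<open>auto simp: less_imp_le\<close>)
  have lim2: "(\<lambda>k. ?I k (\<lambda>x. h x * ln (h x))) \<longlonglongrightarrow> (\<integral>x. h x * ln (h x) \<partial>?\<nu>)"
    by (rule lim[OF _ hln]) auto
  have h_int: "integrable ?\<nu> h"
    by (rule integrable_const_bound[of _ "B\<^sup>2 + \<epsilon>"]) (use h_pos h_le in \<open>auto simp: less_imp_le\<close>)
  have "(\<integral>x. \<epsilon> \<partial>?\<nu>) \<le> (\<integral>x. h x \<partial>?\<nu>)"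
    by (rule integral_mono) (use h_int h_ge in auto)
  then have hbar: "0 < (\<integral>x. h x \<partial>?\<nu>)" using \<epsilon> prob_space by (simp add: measure_def)
  have f'_int: "integrable ?\<nu> (\<lambda>x. (f' x)\<^sup>2)"
    by (rule integrable_const_bound[of _ "B\<^sup>2"]) (use sq in auto)
  have rho_contp: "continuous_on {0<..} \<rho>"
    by (rule continuous_at_imp_continuous_on) (use rho_deriv in \<open>auto intro: DERIV_isCont\<close>)
  have f_cont: "continuous_on {0<..} f"
    by (rule continuous_at_imp_continuous_on) (use f_deriv in \<open>auto intro: DERIV_isCont\<close>)
  have h_cont: "continuous_on {0<..} h"
    unfolding h_def by (intro continuous_intros f_cont)
  define h' where "h' x = 2 * f x * f' x" for x
  have step: "?I k (\<lambda>x. h x * ln (h x)) + ?I k h * ln (?I k (\<lambda>_. 1) / ?I k h) \<le> 2 / c * (\<integral>x. (f' x)\<^sup>2 \<partial>?\<nu>)" for k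
  proof -
    define a where "a = 1 / real (k + 2)" define b where "b = real (k + 2)"
    have ab: "0 < a" "a < b" by (auto simp: a_def b_def field_simps) (smt (verit) mult_nonneg_nonneg of_nat_0_le_iff)
    then have sub: "{a..b} \<subseteq> {0<..}" by auto
    have cr: "continuous_on {a..b} \<rho>" and ch: "continuous_on {a..b} h" and cf': "continuous_on {a..b} f'"
        and cf: "continuous_on {a..b} f"
      using rho_contp h_cont f'_cont f_cont continuous_on_subset[OF _ sub] by blast+
    have ch': "continuous_on {a..b} h'" unfolding h'_def by (intro continuous_intros cf cf')
    have "integral {a..b} (\<lambda>x. h x * \<rho> x * ln (h x)) +
        integral {a..b} (\<lambda>x. h x * \<rho> x) * ln (integral {a..b} \<rho> / integral {a..b} (\<lambda>x. h x * \<rho> x))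
      \<le> integral {a..b} (\<lambda>x. \<rho> x * (h' x)\<^sup>2 / h x) / (2 * c)"
    proof (rule lsi_interval[where v=v])
      show "(h has_real_derivative h' x) (at x)" if "x \<in> {a<..<b}" for x
        unfolding h_def h'_def using that ab
        by (auto intro!: derivative_eq_intros f_deriv)
    qed (use ab c cr ch ch' rho_pos h_pos rho_deriv conv in auto)
    \<comment> \<open>$(h')^2 / h = 4 f^2 (f')^2 / (f^2 + \epsilon) \le 4 (f')^2$.\<close>
    also have "integral {a..b} (\<lambda>x. \<rho> x * (h' x)\<^sup>2 / h x) \<le> integral {a..b} (\<lambda>x. 4 * ((f' x)\<^sup>2 * \<rho> x))"
    proof (rule integral_le)
      show "(\<lambda>x. \<rho> x * (h' x)\<^sup>2 / h x) integrable_on {a..b}"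
        by (intro integrable_continuous_real continuous_intros cr ch ch') (use h_pos in \<open>auto simp: less_imp_neq[symmetric]\<close>)
      show "(\<lambda>x. 4 * ((f' x)\<^sup>2 * \<rho> x)) integrable_on {a..b}"
        by (intro integrable_continuous_real continuous_intros cr cf')
      fix x
      have "(h' x)\<^sup>2 / h x = 4 * (f' x)\<^sup>2 * ((f x)\<^sup>2 / h x)"
        by (simp add: h'_def power_mult_distrib)
      also have "\<dots> \<le> 4 * (f' x)\<^sup>2 * 1"
        using h_pos[of x] \<epsilon> by (intro mult_left_mono) (auto simp: h_def)
      finally have "\<rho> x * ((h' x)\<^sup>2 / h x) \<le> \<rho> x * (4 * (f' x)\<^sup>2)"
        using nonneg[of x] by (intro mult_left_mono) auto
      then show "\<rho> x * (h' x)\<^sup>2 / h x \<le> 4 * ((f' x)\<^sup>2 * \<rho> x)" by (simp add: algebra_simps)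
    qed
    also have "integral {a..b} (\<lambda>x. 4 * ((f' x)\<^sup>2 * \<rho> x)) = 4 * integral {a..b} (\<lambda>x. (f' x)\<^sup>2 * \<rho> x)"
      by simp
    also have "integral {a..b} (\<lambda>x. (f' x)\<^sup>2 * \<rho> x) \<le> (\<integral>x. (f' x)\<^sup>2 \<partial>?\<nu>)"
    proof -
      have int: "integrable lborel (\<lambda>x. (f' x)\<^sup>2 * \<rho> x)"
        using f'_int by (subst (asm) integrable_real_density) (use nonneg in \<open>auto simp: mult.commute\<close>)
      have "integral {a..b} (\<lambda>x. (f' x)\<^sup>2 * \<rho> x) = (\<integral>x. indicator {a..b} x * ((f' x)\<^sup>2 * \<rho> x) \<partial>lborel)"
        using set_borel_integral_eq_integral(2)[of "{a..b}" "\<lambda>x. (f' x)\<^sup>2 * \<rho> x"]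
          integrable_mult_indicator[OF _ int, of "{a..b}"]
        by (simp add: set_integrable_def set_lebesgue_integral_def)
      also have "\<dots> \<le> (\<integral>x. (f' x)\<^sup>2 * \<rho> x \<partial>lborel)"
        by (rule integral_mono) (use int integrable_mult_indicator[OF _ int, of "{a..b}"] nonneg in \<open>auto simp: indicator_def\<close>)
      also have "\<dots> = (\<integral>x. (f' x)\<^sup>2 \<partial>?\<nu>)"
        by (subst integral_real_density) (use nonneg in \<open>auto simp: mult.commute\<close>)
      finally show ?thesis .
    qed
    finally show ?thesis using c by (simp add: a_def b_def field_simps)
  qed
  have "(\<lambda>k. ?I k (\<lambda>x. h x * ln (h x)) + ?I k h * ln (?I k (\<lambda>_. 1) / ?I k h))
      \<longlonglongrightarrow> (\<integral>x. h x * ln (h x) \<partial>?\<nu>) + (\<integral>x. h x \<partial>?\<nu>) * ln (1 / (\<integral>x. h x \<partial>?\<nu>))"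
    by (intro tendsto_intros lim0 lim1 lim2) (use hbar in auto)
  then have "(\<integral>x. h x * ln (h x) \<partial>?\<nu>) + (\<integral>x. h x \<partial>?\<nu>) * ln (1 / (\<integral>x. h x \<partial>?\<nu>)) \<le> 2 / c * (\<integral>x. (f' x)\<^sup>2 \<partial>?\<nu>)"
    by (rule LIMSEQ_le_const2) (use step in auto)
  then show ?thesis using hbar unfolding Ent_def h_def[symmetric] by (simp add: ln_div)
qed

section \<open>The laws of the moduli\<close>

definition radial_weight :: "real \<Rightarrow> nat \<Rightarrow> real \<Rightarrow> real" where
  "radial_weight N a r = (if 0 < r then r ^ (2 * a + 1) * exp (- N * r\<^sup>2) else 0)"

definition radial_mass :: "real \<Rightarrow> nat \<Rightarrow> real" where
  "radial_mass N a = (\<integral>r. radial_weight N a r \<partial>lborel)"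

text \<open>
  The law of the modulus of a point of density proportional to $|z|^{2a} e^{-N|z|^2}$ in the plane; the
  additional factor \<open>r\<close> in \<open>radial_weight\<close> is the Jacobian of polar coordinates.
\<close>

definition radial_law :: "real \<Rightarrow> nat \<Rightarrow> real measure" where
  "radial_law N a = density lborel (\<lambda>r. radial_weight N a r / radial_mass N a)"

lemma radial_weight_measurable[measurable]: "radial_weight N a \<in> borel_measurable borel"
  unfolding radial_weight_def by measurable

lemma radial_weight_nonneg: "0 \<le> radial_weight N a r"
  by (simp add: radial_weight_def)

lemma has_bochner_integral_radial_weight:
  assumes "0 < N"
  shows "has_bochner_integral lborel (radial_weight N a) (fact a / (2 * sqrt N ^ (2 * a + 2)))"
proof -
  let ?s = "sqrt N"
  have s: "0 < ?s" using assms by simp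
  \<comment> \<open>The odd absolute moments of the standard Gaussian weight, rescaled by $\sqrt N$.\<close>
  have "has_bochner_integral lborel (\<lambda>x. indicator {0..} (0 + ?s * x) *\<^sub>R (exp (- (0 + ?s * x)\<^sup>2) * (0 + ?s * x) ^ (2 * a + 1)))
      ((fact a / 2) /\<^sub>R \<bar>?s\<bar>)"
    by (subst lborel_has_bochner_integral_real_affine_iff[symmetric]) (use s gaussian_moment_odd_pos[of a] in simp_all)
  from has_bochner_integral_mult_right[OF this, of "1 / ?s ^ (2 * a + 1)"]
  have "has_bochner_integral lborel (\<lambda>x. 1 / ?s ^ (2 * a + 1) * (indicator {0..} (0 + ?s * x) *\<^sub>R (exp (- (0 + ?s * x)\<^sup>2) * (0 + ?s * x) ^ (2 * a + 1))))
      (1 / ?s ^ (2 * a + 1) * ((fact a / 2) /\<^sub>R \<bar>?s\<bar>))" by simp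
  moreover have "1 / ?s ^ (2 * a + 1) * (indicator {0..} (0 + ?s * x) *\<^sub>R (exp (- (0 + ?s * x)\<^sup>2) * (0 + ?s * x) ^ (2 * a + 1)))
      = radial_weight N a x" for x
    using s assms by (cases "0 < x"; cases "x = 0")
      (auto simp: radial_weight_def indicator_def power_mult_distrib zero_le_mult_iff)
  moreover have "1 / ?s ^ (2 * a + 1) * ((fact a / 2) /\<^sub>R \<bar>?s\<bar>) = fact a / (2 * ?s ^ (2 * a + 2))"
    using s by (simp add: field_simps)
  ultimately show ?thesis by simp
qed

lemma radial_mass_pos: "0 < N \<Longrightarrow> 0 < radial_mass N a"
  using has_bochner_integral_radial_weight[of N a] unfolding radial_mass_def
  by (simp add: has_bochner_integral_iff)

lemma integrable_radial_weight: "0 < N \<Longrightarrow> integrable lborel (radial_weight N a)"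
  using has_bochner_integral_radial_weight[of N a] by (simp add: has_bochner_integral_iff)

lemma sets_radial_law[measurable_cong, simp]: "sets (radial_law N a) = sets borel"
  and space_radial_law[simp]: "space (radial_law N a) = UNIV"
  by (simp_all add: radial_law_def)

lemma prob_space_radial_law:
  assumes "0 < N" shows "prob_space (radial_law N a)"
proof (rule prob_spaceI)
  have "emeasure (radial_law N a) (space (radial_law N a)) = (\<integral>\<^sup>+r. ennreal (radial_weight N a r / radial_mass N a) \<partial>lborel)"
    by (simp add: radial_law_def emeasure_density)
  also have "\<dots> = ennreal (\<integral>r. radial_weight N a r / radial_mass N a \<partial>lborel)"
    using radial_mass_pos[OF assms, of a] radial_weight_nonneg integrable_radial_weight[OF assms]
    by (intro nn_integral_eq_integral) (auto simp: less_imp_le)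
  also have "\<dots> = 1"
    using radial_mass_pos[OF assms, of a] unfolding radial_mass_def by simp
  finally show "emeasure (radial_law N a) (space (radial_law N a)) = 1" .
qed

text \<open>
  The convexity constant $2N$ of the potential $N x^2 - (2a+1) \ln x$ comes from the square alone:
  concavity of the logarithm has the right sign for every exponent, so the constant does not depend
  on \<open>a\<close>.
\<close>

lemma lsi_radial_law:
  fixes f f' :: "real \<Rightarrow> real"
  assumes N: "0 < N" and \<epsilon>: "0 < \<epsilon>"
    and f_meas: "f \<in> borel_measurable borel" and f'_meas: "f' \<in> borel_measurable borel"
    and f_deriv: "\<And>x. 0 < x \<Longrightarrow> (f has_real_derivative f' x) (at x)"
    and f'_cont: "continuous_on {0<..} f'"
    and f_bound: "\<And>x. \<bar>f x\<bar> \<le> B" and f'_bound: "\<And>x. \<bar>f' x\<bar> \<le> B"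
  shows "Ent (radial_law N a) (\<lambda>x. (f x)\<^sup>2 + \<epsilon>) \<le> 1 / N * (\<integral>x. (f' x)\<^sup>2 \<partial>radial_law N a)"
proof -
  let ?Z = "radial_mass N a"
  let ?\<rho> = "\<lambda>r. radial_weight N a r / ?Z"
  define m where "m = real (2 * a + 1)"
  define v where "v x = 2 * N * x - m / x" for x
  have Z: "0 < ?Z" by (rule radial_mass_pos[OF N])
  have ln_rho: "ln (?\<rho> x) = m * ln x - N * x\<^sup>2 - ln ?Z" if "0 < x" for x
  proof -
    have "ln (?\<rho> x) = ln (x ^ (2 * a + 1) * exp (- N * x\<^sup>2)) - ln ?Z"
      using that Z by (subst ln_div) (auto simp: radial_weight_def)
    also have "ln (x ^ (2 * a + 1) * exp (- N * x\<^sup>2)) = ln (x ^ (2 * a + 1)) + ln (exp (- N * x\<^sup>2))"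
      using that by (intro ln_mult_pos) (simp_all del: power_Suc)
    also have "\<dots> = m * ln x - N * x\<^sup>2" unfolding m_def using that by (subst ln_realpow) simp_all
    finally show ?thesis by simp
  qed
  have "Ent (density lborel ?\<rho>) (\<lambda>x. (f x)\<^sup>2 + \<epsilon>) \<le> 2 / (2 * N) * (\<integral>x. (f' x)\<^sup>2 \<partial>density lborel ?\<rho>)"
  proof (rule lsi_halfline[where v=v and B=B])
    show "0 < 2 * N" using N by simp
    show "prob_space (density lborel ?\<rho>)"
      using prob_space_radial_law[OF N, of a] by (simp add: radial_law_def)
    fix x :: real assume x: "0 < x"
    show "0 < ?\<rho> x" using x Z by (simp add: radial_weight_def)
    have pow: "((\<lambda>r. r ^ (2 * a + 1)) has_real_derivative m / x * x ^ (2 * a + 1)) (at x)"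
      using DERIV_pow[of "2 * a + 1" x UNIV] x by (simp add: m_def)
    have "((\<lambda>r. r ^ (2 * a + 1) * exp (- N * r\<^sup>2) / ?Z) has_real_derivative - v x * ?\<rho> x) (at x)"
      by (rule derivative_eq_intros pow refl)+
        (use x Z in \<open>simp_all add: v_def radial_weight_def field_simps power2_eq_square\<close>)
    then show "(?\<rho> has_real_derivative - v x * ?\<rho> x) (at x)"
      by (rule has_field_derivative_transform_within[where d=x]) (use x in \<open>auto simp: radial_weight_def dist_real_def\<close>)
    fix y :: real assume y: "0 < y"
    have "ln y - ln x \<le> (y - x) / x" by (rule ln_diff_le[OF y x])
    then have "m * (ln y - ln x) \<le> m * ((y - x) / x)" by (intro mult_left_mono) (auto simp: m_def)
    then show "ln (?\<rho> y) \<le> ln (?\<rho> x) - v x * (y - x) - 2 * N / 2 * (y - x)\<^sup>2"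
      unfolding ln_rho[OF x] ln_rho[OF y] v_def by (simp add: algebra_simps power2_eq_square)
  qed (use \<epsilon> f_meas f'_meas f_deriv f'_cont f_bound f'_bound in \<open>auto simp: radial_weight_def\<close>)
  then show ?thesis by (simp add: radial_law_def)
qed

section \<open>Subadditivity of entropy on product spaces\<close>

lemma abs_ln_le:
  fixes t :: real
  assumes "0 < \<epsilon>" "\<epsilon> \<le> t" "t \<le> B" shows "\<bar>ln t\<bar> \<le> \<bar>ln \<epsilon>\<bar> + \<bar>ln B\<bar>"
proof -
  have "ln \<epsilon> \<le> ln t" "ln t \<le> ln B" using assms by (auto intro!: ln_mono)
  then show ?thesis by linarith
qed

lemma abs_mult_ln_le:
  fixes s t :: real
  assumes "0 < \<epsilon>" "\<epsilon> \<le> s" "s \<le> B" "\<epsilon> \<le> t" "t \<le> B"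
  shows "\<bar>s * ln t\<bar> \<le> B * (\<bar>ln \<epsilon>\<bar> + \<bar>ln B\<bar>)"
  unfolding abs_mult using assms abs_ln_le[of \<epsilon> t B] by (intro mult_mono) auto

text \<open>
  The variational formula for entropy of Donsker and Varadhan: among all \<open>g\<close> the left-hand side is
  largest for \<open>g = h\<close>. It is nonnegativity of relative entropy, that is, \<open>ln t \<le> t - 1\<close> integrated
  against $h\,d\nu$.
\<close>

lemma integral_mult_ln_le_Ent:
  assumes "prob_space \<nu>" and [measurable]: "h \<in> borel_measurable \<nu>" "g \<in> borel_measurable \<nu>"
    and \<epsilon>: "0 < \<epsilon>"
    and h: "\<And>x. \<epsilon> \<le> h x" "\<And>x. h x \<le> (B::real)" and g: "\<And>x. \<epsilon> \<le> g x" "\<And>x. g x \<le> B"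
  shows "(\<integral>x. h x * ln (g x) \<partial>\<nu>) - (\<integral>x. h x \<partial>\<nu>) * ln (\<integral>x. g x \<partial>\<nu>) \<le> Ent \<nu> h"
proof -
  interpret prob_space \<nu> by fact
  have B: "0 < B" using \<epsilon> h(1)[of undefined] h(2)[of undefined] by linarith
  have pos: "0 < h x" "0 < g x" for x using h(1)[of x] g(1)[of x] \<epsilon> by auto
  have ih: "integrable \<nu> h" and ig: "integrable \<nu> g"
    by (auto intro!: integrable_const_bound[of _ B] simp: h g less_imp_le pos)
  have ihg: "integrable \<nu> (\<lambda>x. h x * ln (g x))" and ihh: "integrable \<nu> (\<lambda>x. h x * ln (h x))"
    by (rule integrable_const_bound[of _ "B * (\<bar>ln \<epsilon>\<bar> + \<bar>ln B\<bar>)"];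
        use abs_mult_ln_le[OF \<epsilon> h g] abs_mult_ln_le[OF \<epsilon> h h] in simp)+
  have "(\<integral>x. \<epsilon> \<partial>\<nu>) \<le> (\<integral>x. h x \<partial>\<nu>)" "(\<integral>x. \<epsilon> \<partial>\<nu>) \<le> (\<integral>x. g x \<partial>\<nu>)"
    by (rule integral_mono; use ih ig h g in simp)+
  then have H: "0 < (\<integral>x. h x \<partial>\<nu>)" and G: "0 < (\<integral>x. g x \<partial>\<nu>)"
    using \<epsilon> prob_space by simp_all
  let ?H = "\<integral>x. h x \<partial>\<nu>" and ?G = "\<integral>x. g x \<partial>\<nu>"
  \<comment> \<open>\<open>ln t \<le> t - 1\<close> at \<open>t\<close> equal to the ratio of the normalised \<open>g\<close> and \<open>h\<close>; the right-hand side has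
    integral 0.\<close>
  have pt: "h x * ln (g x) - h x * ln (h x) + h x * ln (?H / ?G) \<le> g x * (?H / ?G) - h x" for x
  proof -
    have "ln (g x) - ln (h x) + ln (?H / ?G) = ln (g x / h x * (?H / ?G))"
      using pos[of x] H G by (simp add: ln_mult ln_div)
    also have "\<dots> \<le> g x / h x * (?H / ?G) - 1"
      using pos[of x] H G by (intro ln_le_minus_one) auto
    finally have "h x * (ln (g x) - ln (h x) + ln (?H / ?G)) \<le> h x * (g x / h x * (?H / ?G) - 1)"
      using pos[of x] by (intro mult_left_mono) auto
    then show ?thesis using pos[of x] by (simp add: algebra_simps)
  qed
  have "(\<integral>x. h x * ln (g x) - h x * ln (h x) + h x * ln (?H / ?G) \<partial>\<nu>) \<le> (\<integral>x. g x * (?H / ?G) - h x \<partial>\<nu>)"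
    by (rule integral_mono) (use pt ihg ihh ih ig in auto)
  also have "\<dots> = 0"
    using ih ig G by simp
  finally have "(\<integral>x. h x * ln (g x) \<partial>\<nu>) - (\<integral>x. h x * ln (h x) \<partial>\<nu>) + ?H * ln (?H / ?G) \<le> 0"
    using ihg ihh ih by simp
  then show ?thesis using H G by (simp add: Ent_def ln_div algebra_simps)
qed

context
  fixes \<nu> :: "'i::finite \<Rightarrow> 'a measure"
  assumes prob: "\<And>i. prob_space (\<nu> i)" and space: "\<And>i. space (\<nu> i) = UNIV"
begin

interpretation product_prob_space \<nu> UNIV
  by (rule product_prob_spaceI) (rule prob)

interpretation P: prob_space "PiM UNIV \<nu>"
  by (rule prob_space_PiM) (rule prob)

text \<open>
  Conditional expectation given all coordinates except the \<open>i\<close>-th.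
\<close>

definition avg :: "'i \<Rightarrow> (('i \<Rightarrow> 'a) \<Rightarrow> real) \<Rightarrow> ('i \<Rightarrow> 'a) \<Rightarrow> real" where
  "avg i h x = (\<integral>t. h (x(i := t)) \<partial>\<nu> i)"

lemma space_PiM_UNIV: "space (PiM UNIV \<nu>) = UNIV"
  by (simp add: space_PiM space)

lemma measurable_update_pair:
  "(\<lambda>(x, t). x(i := t)) \<in> PiM UNIV \<nu> \<Otimes>\<^sub>M \<nu> i \<rightarrow>\<^sub>M PiM UNIV \<nu>"
proof -
  have "(\<lambda>p. (fst p)(i := snd p)) \<in> PiM UNIV \<nu> \<Otimes>\<^sub>M \<nu> i \<rightarrow>\<^sub>M PiM UNIV \<nu>"
  proof (rule measurable_PiM_single')
    fix j :: 'i
    show "(\<lambda>p. ((fst p)(i := snd p)) j) \<in> PiM UNIV \<nu> \<Otimes>\<^sub>M \<nu> i \<rightarrow>\<^sub>M \<nu> j"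
      by (cases "j = i") auto
  qed (auto simp: space space_pair_measure)
  then show ?thesis by (simp add: case_prod_beta')
qed

lemma measurable_comp_update:
  assumes "h \<in> borel_measurable (PiM UNIV \<nu>)"
  shows "(\<lambda>(x, t). h (x(i := t))) \<in> borel_measurable (PiM UNIV \<nu> \<Otimes>\<^sub>M \<nu> i)"
  using measurable_compose[OF measurable_update_pair assms] by (simp add: case_prod_beta')

lemma measurable_avg[measurable]:
  assumes "h \<in> borel_measurable (PiM UNIV \<nu>)"
  shows "avg i h \<in> borel_measurable (PiM UNIV \<nu>)"
  unfolding avg_def[abs_def]
  by (rule M.borel_measurable_lebesgue_integral[OF measurable_comp_update[OF assms]])

lemma measurable_update_at[measurable]:
  assumes "h \<in> borel_measurable (PiM UNIV \<nu>)"
  shows "(\<lambda>t. h (x(i := t))) \<in> borel_measurable (\<nu> i)"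
  using measurable_compose[OF measurable_Pair1' measurable_comp_update[OF assms, of i]]
  by (simp add: space_PiM_UNIV)

lemma avg_bounds:
  assumes [measurable]: "h \<in> borel_measurable (PiM UNIV \<nu>)" and "\<And>x. a \<le> h x" "\<And>x. h x \<le> B"
  shows "a \<le> avg i h x" "avg i h x \<le> B"
proof -
  have bnd: "\<bar>h y\<bar> \<le> \<bar>a\<bar> + \<bar>B\<bar>" for y
    using assms(2)[of y] assms(3)[of y] by linarith
  have int: "integrable (\<nu> i) (\<lambda>t. h (x(i := t)))"
    by (rule M.integrable_const_bound[of _ "\<bar>a\<bar> + \<bar>B\<bar>"])
       (use assms bnd in auto)
  have "(\<integral>t. a \<partial>\<nu> i) \<le> avg i h x" "avg i h x \<le> (\<integral>t. B \<partial>\<nu> i)"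
    unfolding avg_def by (rule integral_mono; use int assms in simp)+
  then show "a \<le> avg i h x" "avg i h x \<le> B" using M.prob_space by simp_all
qed

lemma integral_avg:
  assumes [measurable]: "h \<in> borel_measurable (PiM UNIV \<nu>)" and "\<And>x. \<bar>h x\<bar> \<le> B"
  shows "(\<integral>x. avg i h x \<partial>PiM UNIV \<nu>) = (\<integral>x. h x \<partial>PiM UNIV \<nu>)"
proof -
  have ins: "insert i (UNIV - {i}) = UNIV" by auto
  have ih: "integrable (PiM UNIV \<nu>) h"
    by (rule P.integrable_const_bound[of _ B]) (use assms in auto)
  have ia: "integrable (PiM UNIV \<nu>) (avg i h)"
    by (rule P.integrable_const_bound[of _ B])
       (use avg_bounds[of h "-B" B] assms in \<open>auto simp: abs_le_iff minus_le_iff\<close>)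
  \<comment> \<open>Fubini in the \<open>i\<close>-th coordinate; the averaged function no longer depends on it.\<close>
  have fold: "(\<integral>x. k x \<partial>PiM UNIV \<nu>) = (\<integral>x. (\<integral>t. k (x(i := t)) \<partial>\<nu> i) \<partial>PiM (UNIV - {i}) \<nu>)"
    if "integrable (PiM UNIV \<nu>) k" for k :: "('i \<Rightarrow> 'a) \<Rightarrow> real"
    using product_integral_insert[of "UNIV - {i}" i k] that by (simp add: ins)
  have "(\<integral>x. avg i h x \<partial>PiM UNIV \<nu>) = (\<integral>x. (\<integral>t. avg i h (x(i := t)) \<partial>\<nu> i) \<partial>PiM (UNIV - {i}) \<nu>)"
    by (rule fold[OF ia])
  also have "\<dots> = (\<integral>x. avg i h x \<partial>PiM (UNIV - {i}) \<nu>)"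
    using M.prob_space by (simp add: avg_def)
  also have "\<dots> = (\<integral>x. h x \<partial>PiM UNIV \<nu>)" unfolding fold[OF ih] avg_def ..
  finally show ?thesis .
qed

lemma Ent_update_eq_avg:
  "Ent (\<nu> i) (\<lambda>t. h (x(i := t))) = avg i (\<lambda>x. h x * ln (h x)) x - avg i h x * ln (avg i h x)"
  by (simp add: Ent_def avg_def)

text \<open>
  Average \<open>h\<close> successively over the coordinates in \<open>S\<close>. Each step replaces \<open>g\<close> by \<open>avg i g\<close> in the
  logarithm; for fixed other coordinates this changes the integral by at most the entropy in the
  \<open>i\<close>-th coordinate, by the variational formula with the test function \<open>g\<close>. The changes telescope.
\<close>

lemma Ent_PiM_partial:
  assumes [measurable]: "h \<in> borel_measurable (PiM UNIV \<nu>)"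
    and \<epsilon>: "0 < \<epsilon>" and h: "\<And>x. \<epsilon> \<le> h x" "\<And>x. h x \<le> B"
  shows "\<exists>g\<in>borel_measurable (PiM UNIV \<nu>). (\<forall>x. \<epsilon> \<le> g x \<and> g x \<le> B) \<and>
      (\<forall>i\<in>S. \<forall>x t. g (x(i := t)) = g x) \<and>
      (\<integral>x. g x \<partial>PiM UNIV \<nu>) = (\<integral>x. h x \<partial>PiM UNIV \<nu>) \<and>
      (\<integral>x. h x * ln (h x) \<partial>PiM UNIV \<nu>) - (\<integral>x. h x * ln (g x) \<partial>PiM UNIV \<nu>)
        \<le> (\<Sum>i\<in>S. \<integral>x. Ent (\<nu> i) (\<lambda>t. h (x(i := t))) \<partial>PiM UNIV \<nu>)"
proof (induction S rule: finite_induct[OF finite])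
  case 1
  show ?case by (rule bexI[of _ h]) (use h in auto)
next
  case (2 i S)
  let ?\<pi> = "PiM UNIV \<nu>"
  obtain g where [measurable]: "g \<in> borel_measurable ?\<pi>" and g: "\<And>x. \<epsilon> \<le> g x" "\<And>x. g x \<le> B"
    and indep: "\<And>i x t. i \<in> S \<Longrightarrow> g (x(i := t)) = g x"
    and g_int: "(\<integral>x. g x \<partial>?\<pi>) = (\<integral>x. h x \<partial>?\<pi>)"
    and le: "(\<integral>x. h x * ln (h x) \<partial>?\<pi>) - (\<integral>x. h x * ln (g x) \<partial>?\<pi>)
        \<le> (\<Sum>i\<in>S. \<integral>x. Ent (\<nu> i) (\<lambda>t. h (x(i := t))) \<partial>?\<pi>)"
    using 2 by blast
  define g' where "g' = avg i g"
  have [measurable]: "g' \<in> borel_measurable ?\<pi>" by (simp add: g'_def)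
  have g': "\<And>x. \<epsilon> \<le> g' x" "\<And>x. g' x \<le> B"
    unfolding g'_def using avg_bounds[of g \<epsilon> B i] g by simp_all
  let ?K = "B * (\<bar>ln \<epsilon>\<bar> + \<bar>ln B\<bar>)"
  have K: "\<And>x. \<bar>h x * ln (g x)\<bar> \<le> ?K" "\<And>x. \<bar>h x * ln (g' x)\<bar> \<le> ?K" "\<And>x. \<bar>h x * ln (h x)\<bar> \<le> ?K"
    by (rule abs_mult_ln_le[OF \<epsilon> h]; use g g' h in simp)+
  have h': "\<And>x. \<epsilon> \<le> avg i h x" "\<And>x. avg i h x \<le> B"
    using avg_bounds[of h \<epsilon> B i] h by simp_all
  have bounds: "- ?K \<le> avg i (\<lambda>x. h x * ln (k x)) x" "avg i (\<lambda>x. h x * ln (k x)) x \<le> ?K"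
    if [measurable]: "k \<in> borel_measurable ?\<pi>" and "\<And>x. \<bar>h x * ln (k x)\<bar> \<le> ?K" for k x
    using avg_bounds[of "\<lambda>x. h x * ln (k x)" "- ?K" ?K i x] that(2)
    by (simp_all add: abs_le_iff minus_le_iff)
  have int1: "integrable ?\<pi> (\<lambda>x. avg i (\<lambda>x. h x * ln (k x)) x)"
    if [measurable]: "k \<in> borel_measurable ?\<pi>" and "\<And>x. \<bar>h x * ln (k x)\<bar> \<le> ?K" for k
    by (rule P.integrable_const_bound[of _ ?K]) (use bounds[OF that] in \<open>auto simp: abs_le_iff minus_le_iff\<close>)
  have int2: "integrable ?\<pi> (\<lambda>x. avg i h x * ln (g' x))" "integrable ?\<pi> (\<lambda>x. avg i h x * ln (avg i h x))"
    by (rule P.integrable_const_bound[of _ ?K]; use abs_mult_ln_le[OF \<epsilon> h'] g' h' in simp)+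
  have "(\<integral>x. h x * ln (g x) \<partial>?\<pi>) - (\<integral>x. h x * ln (g' x) \<partial>?\<pi>)
      = (\<integral>x. avg i (\<lambda>x. h x * ln (g x)) x \<partial>?\<pi>) - (\<integral>x. avg i (\<lambda>x. h x * ln (g' x)) x \<partial>?\<pi>)"
    using K by (subst (1 2) integral_avg[where B="?K"]) auto
  also have "(\<lambda>x. avg i (\<lambda>x. h x * ln (g' x)) x) = (\<lambda>x. avg i h x * ln (g' x))"
    by (simp add: avg_def g'_def)
  also have "(\<integral>x. avg i (\<lambda>x. h x * ln (g x)) x \<partial>?\<pi>) - (\<integral>x. avg i h x * ln (g' x) \<partial>?\<pi>)
      = (\<integral>x. avg i (\<lambda>x. h x * ln (g x)) x - avg i h x * ln (g' x) \<partial>?\<pi>)"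
    using int1[of g] K int2 by simp
  also have "\<dots> \<le> (\<integral>x. Ent (\<nu> i) (\<lambda>t. h (x(i := t))) \<partial>?\<pi>)"
  proof (rule integral_mono)
    show "integrable ?\<pi> (\<lambda>x. avg i (\<lambda>x. h x * ln (g x)) x - avg i h x * ln (g' x))"
      using int1[of g] K int2 by simp
    show "integrable ?\<pi> (\<lambda>x. Ent (\<nu> i) (\<lambda>t. h (x(i := t))))"
      unfolding Ent_update_eq_avg using int1[of h] K int2 by simp
    show "avg i (\<lambda>x. h x * ln (g x)) x - avg i h x * ln (g' x) \<le> Ent (\<nu> i) (\<lambda>t. h (x(i := t)))" for x
      unfolding g'_def avg_def
      by (rule integral_mult_ln_le_Ent[OF prob _ _ \<epsilon>, where B=B]) (use h g in auto)
  qed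
  finally have "(\<integral>x. h x * ln (h x) \<partial>?\<pi>) - (\<integral>x. h x * ln (g' x) \<partial>?\<pi>)
        \<le> (\<Sum>i\<in>insert i S. \<integral>x. Ent (\<nu> i) (\<lambda>t. h (x(i := t))) \<partial>?\<pi>)"
    using le 2 by simp
  moreover have "(\<integral>x. g' x \<partial>?\<pi>) = (\<integral>x. h x \<partial>?\<pi>)"
    unfolding g'_def g_int[symmetric]
    by (rule integral_avg[where B=B]) (use g \<epsilon> in \<open>auto simp: abs_le_iff\<close>, smt (verit))
  moreover have "g' (x(j := t)) = g' x" if "j \<in> insert i S" for j x t
  proof (cases "j = i")
    case False
    then have "g (x(j := t, i := s)) = g (x(i := s))" for s
      using indep[of j "x(i := s)" t] that by (simp add: fun_upd_twist)
    then show ?thesis by (simp add: g'_def avg_def)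
  qed (simp add: g'_def avg_def)
  ultimately show ?case using g' \<open>g' \<in> borel_measurable ?\<pi>\<close> by blast
qed

lemma independent_imp_constant:
  fixes g :: "('i \<Rightarrow> 'a) \<Rightarrow> 'c"
  assumes "\<And>i x t. g (x(i := t)) = g x"
  shows "g x = g y"
proof -
  have "g (\<lambda>i. if i \<in> S then y i else x i) = g x" for S :: "'i set"
  proof (induction S rule: finite_induct[OF finite])
    case (2 i S)
    have "(\<lambda>j. if j \<in> insert i S then y j else x j) = (\<lambda>j. if j \<in> S then y j else x j)(i := y i)"
      by auto
    then show ?case using assms 2 by metis
  qed auto
  from this[of UNIV] show ?thesis by simp
qed

text \<open>
  After averaging over all coordinates the function in the logarithm is constant, so it is the mean
  of \<open>h\<close>, and the telescoped difference is the full entropy.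
\<close>

theorem Ent_PiM_le:
  assumes "h \<in> borel_measurable (PiM UNIV \<nu>)"
    and "0 < \<epsilon>" and "\<And>x. \<epsilon> \<le> h x" "\<And>x. h x \<le> B"
  shows "Ent (PiM UNIV \<nu>) h \<le> (\<Sum>i\<in>UNIV. \<integral>x. Ent (\<nu> i) (\<lambda>t. h (x(i := t))) \<partial>PiM UNIV \<nu>)"
proof -
  let ?\<pi> = "PiM UNIV \<nu>"
  obtain g where "\<And>i x t. g (x(i := t)) = g x" and g_int: "(\<integral>x. g x \<partial>?\<pi>) = (\<integral>x. h x \<partial>?\<pi>)"
    and le: "(\<integral>x. h x * ln (h x) \<partial>?\<pi>) - (\<integral>x. h x * ln (g x) \<partial>?\<pi>)
        \<le> (\<Sum>i\<in>UNIV. \<integral>x. Ent (\<nu> i) (\<lambda>t. h (x(i := t))) \<partial>?\<pi>)"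
    using Ent_PiM_partial[OF assms, of UNIV] by auto
  then obtain c where c: "g = (\<lambda>_. c)" using independent_imp_constant[of g] by (metis ext)
  then have "c = (\<integral>x. h x \<partial>?\<pi>)" using g_int P.prob_space by simp
  then show ?thesis using le by (simp add: Ent_def c)
qed

end

section \<open>The Vandermonde determinant\<close>

text \<open>
  The exponents \<open>0, \<dots>, n - 1\<close> of the Vandermonde matrix, carried over to the index type.
\<close>

definition rank_of :: "'n::{finite,linorder} \<Rightarrow> nat" where
  "rank_of i = card {..<i}"

lemma rank_of_less: "i < j \<Longrightarrow> rank_of i < rank_of (j :: 'n::{finite,linorder})"
  unfolding rank_of_def by (intro psubset_card_mono) auto

lemma rank_of_le_iff: "rank_of i \<le> rank_of j \<longleftrightarrow> i \<le> (j :: 'n::{finite,linorder})"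
  using rank_of_less by (metis leD leI order.order_iff_strict)

lemma inj_rank_of: "inj (rank_of :: 'n::{finite,linorder} \<Rightarrow> nat)"
  by (rule injI) (metis rank_of_le_iff order_antisym order_refl)

lemma bij_betw_rank_of: "bij_betw (rank_of :: 'n::{finite,linorder} \<Rightarrow> nat) UNIV {..<CARD('n)}"
proof -
  have "rank_of i < CARD('n)" for i :: 'n
    unfolding rank_of_def by (intro psubset_card_mono) auto
  then have "rank_of ` (UNIV :: 'n set) \<subseteq> {..<CARD('n)}" by auto
  then have "rank_of ` (UNIV :: 'n set) = {..<CARD('n)}"
    by (intro card_subset_eq) (auto simp: card_image inj_rank_of)
  then show ?thesis using inj_rank_of by (simp add: bij_betw_def)
qed

text \<open>
  The ranks of the \<open>p i\<close> have the same sum as the ranks of the \<open>i\<close>, so no inequality can be strict.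
\<close>

lemma permutes_le_imp_id:
  fixes p :: "'n::{finite,linorder} \<Rightarrow> 'n"
  assumes p: "p permutes UNIV" and le: "\<And>i. p i \<le> i"
  shows "p = id"
proof -
  have "(\<Sum>i\<in>UNIV. rank_of (p i)) = (\<Sum>i\<in>UNIV. rank_of (i :: 'n))"
    using sum.permute[OF p, of rank_of] by (simp only: o_def)
  then have "rank_of (p i) = rank_of i" for i
    using le by (intro sum_mono_inv[of "\<lambda>i. rank_of (p i)" UNIV rank_of i]) (auto simp: rank_of_le_iff)
  then show ?thesis using inj_rank_of by (auto simp: inj_def fun_eq_iff)
qed

lemma det_triangular:
  fixes A :: "(('a::comm_ring_1, 'n) vec, 'n::{finite,linorder}) vec"
  assumes "\<And>i j. i < j \<Longrightarrow> A $ i $ j = 0"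
  shows "det A = (\<Prod>i\<in>UNIV. A $ i $ i)"
proof -
  let ?t = "\<lambda>p. of_int (sign p) * (\<Prod>i\<in>UNIV. A $ i $ p i)"
  have "det A = (\<Sum>p\<in>{id}. ?t p)"
    unfolding det_def
  proof (rule sum.mono_neutral_right)
    show "\<forall>p\<in>{p. p permutes UNIV} - {id}. ?t p = 0"
    proof
      fix p :: "'n \<Rightarrow> 'n" assume "p \<in> {p. p permutes UNIV} - {id}"
      then obtain i where "i < p i" using permutes_le_imp_id[of p] by (auto simp: not_le[symmetric])
      then have "(\<Prod>i\<in>UNIV. A $ i $ p i) = 0" using assms by (intro prod_zero) auto
      then show "?t p = 0" by simp
    qed
  qed (auto simp: permutes_id finite_permutations)
  then show ?thesis by simp
qed

text \<open>
  Change from monomials to the Newton basis $P_j = \prod_{l<j} (X - z_l)$. The change of basis is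
  unitriangular because $P_j$ is monic of degree \<open>rank_of j\<close>, and the matrix of the values $P_j(z_i)$ is
  triangular because $P_j$ vanishes at the earlier nodes.
\<close>

lemma vandermonde_det:
  fixes z :: "('a::field, 'n::{finite,linorder}) vec"
  shows "det (\<chi> i j. (z $ i) ^ rank_of j) = (\<Prod>i\<in>UNIV. \<Prod>l\<in>{..<i}. z $ i - z $ l)"
proof -
  define P where "P j = (\<Prod>l\<in>{..<j}. [:- (z $ l), 1:])" for j
  have deg: "degree (P j) = rank_of j" for j
    unfolding P_def rank_of_def by (subst degree_prod_eq_sum_degree) auto
  have monic: "coeff (P j) (rank_of j) = 1" for j
    using lead_coeff_prod[of "\<lambda>l. [:- (z $ l), 1:]" "{..<j}"] deg[of j] by (simp add: P_def)
  define V :: "(('a, 'n) vec, 'n) vec" where "V = (\<chi> i j. (z $ i) ^ rank_of j)"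
  define C :: "(('a, 'n) vec, 'n) vec" where "C = (\<chi> k j. coeff (P j) (rank_of k))"
  have "det C = det (transpose C)" by (simp add: det_transpose)
  also have "\<dots> = (\<Prod>i\<in>UNIV. transpose C $ i $ i)"
  proof (rule det_triangular)
    fix i j :: 'n assume "i < j"
    then show "transpose C $ i $ j = 0"
      by (simp add: transpose_def C_def coeff_eq_0 deg rank_of_less)
  qed
  also have "\<dots> = 1" by (simp add: transpose_def C_def monic)
  finally have detC: "det C = 1" .
  have VC: "(V ** C) $ i $ j = (\<Prod>l\<in>{..<j}. z $ i - z $ l)" for i j
  proof -
    have "(V ** C) $ i $ j = (\<Sum>k\<in>(UNIV :: 'n set). (z $ i) ^ rank_of k * coeff (P j) (rank_of k))"
      by (simp add: matrix_matrix_mult_def V_def C_def)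
    also have "\<dots> = (\<Sum>m<CARD('n). (z $ i) ^ m * coeff (P j) m)"
      by (rule sum.reindex_bij_betw[OF bij_betw_rank_of])
    also have "\<dots> = (\<Sum>m\<le>degree (P j). coeff (P j) m * (z $ i) ^ m)"
    proof (rule sum.mono_neutral_cong_right)
      have "rank_of j < CARD('n)" using bij_betw_rank_of by (auto simp: bij_betw_def)
      then show "{..degree (P j)} \<subseteq> {..<CARD('n)}" by (auto simp: deg)
    qed (auto simp: coeff_eq_0 mult.commute)
    also have "\<dots> = poly (P j) (z $ i)" by (simp add: poly_altdef)
    finally show ?thesis by (simp add: P_def poly_prod)
  qed
  have "det V = det (V ** C)" by (simp add: det_mul detC)
  also have "\<dots> = (\<Prod>i\<in>UNIV. (V ** C) $ i $ i)"
    by (rule det_triangular) (auto simp: VC intro!: prod_zero)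
  finally have "det V = (\<Prod>i\<in>UNIV. \<Prod>l\<in>{..<i}. z $ i - z $ l)" unfolding VC .
  then show ?thesis unfolding V_def .
qed

lemma vandermonde_expansion:
  fixes z :: "('a::field, 'n::{finite,linorder}) vec"
  shows "(\<Prod>i\<in>UNIV. \<Prod>l\<in>{..<i}. z $ i - z $ l) =
    (\<Sum>p | p permutes UNIV. of_int (sign p) * (\<Prod>i\<in>UNIV. (z $ i) ^ rank_of (p i)))"
  unfolding vandermonde_det[symmetric] by (simp add: det_def)

text \<open>
  The squared modulus of the Vandermonde product is the product of two Leibniz sums, one of them
  conjugated; the Gaussian factor splits over the coordinates. So the weight is a finite sum of
  products of functions of a single coordinate.
\<close>

lemma ginibre_weight_expansion:
  fixes z :: "'n::{finite,linorder} cspace"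
  shows "complex_of_real (ginibre_weight z) =
    (\<Sum>p | p permutes UNIV. \<Sum>q | q permutes UNIV. of_int (sign p * sign q) *
      (\<Prod>i\<in>UNIV. (z $ i) ^ rank_of (p i) * cnj (z $ i) ^ rank_of (q i) *
         of_real (exp (- real CARD('n) * (cmod (z $ i))\<^sup>2))))"
proof -
  let ?D = "\<Prod>i\<in>UNIV. \<Prod>l\<in>{..<i}. z $ i - z $ l"
  have "(\<Prod>(j, k)\<in>{(j, k). j < k}. (cmod (z $ j - z $ k))\<^sup>2) =
      (\<Prod>k\<in>UNIV. \<Prod>j\<in>{..<k}. (cmod (z $ k - z $ j))\<^sup>2)"
    by (subst prod.Sigma) (auto simp: norm_minus_commute intro!: prod.reindex_bij_witness[of _ prod.swap prod.swap])
  also have "\<dots> = (cmod ?D)\<^sup>2"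
    by (simp add: prod_norm[symmetric] prod_power_distrib)
  finally have "complex_of_real (ginibre_weight z) =
      ?D * cnj ?D * of_real (exp (- real CARD('n) * (\<Sum>k\<in>UNIV. (cmod (z $ k))\<^sup>2)))"
    by (simp add: ginibre_weight_def complex_norm_square mult.commute del: cnj_prod of_real_power)
  also have "exp (- real CARD('n) * (\<Sum>k\<in>UNIV. (cmod (z $ k))\<^sup>2)) =
      (\<Prod>i\<in>UNIV. exp (- real CARD('n) * (cmod (z $ i))\<^sup>2))"
    by (simp add: exp_sum[symmetric] sum_distrib_left)
  also have "complex_of_real \<dots> = (\<Prod>i\<in>UNIV. of_real (exp (- real CARD('n) * (cmod (z $ i))\<^sup>2)))" (is "_ = ?E")
    by simp
  also have "?D * cnj ?D * ?E = (\<Sum>p | p permutes UNIV. \<Sum>q | q permutes UNIV.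
      of_int (sign p) * (\<Prod>i\<in>UNIV. (z $ i) ^ rank_of (p i)) *
      (of_int (sign q) * (\<Prod>i\<in>UNIV. cnj (z $ i) ^ rank_of (q i))) * ?E)"
    unfolding vandermonde_expansion cnj_sum complex_cnj_mult complex_cnj_of_int cnj_prod
      complex_cnj_power sum_product by (simp only: sum_distrib_right)
  finally show ?thesis
    by (simp add: prod.distrib mult_ac)
qed

section \<open>Lebesgue measure on complex vectors and its rotation invariance\<close>

lemma lborel_vec_eq_PiM:
  "(lborel :: ('a::euclidean_space ^ 'n::finite) measure) = distr (PiM UNIV (\<lambda>_. lborel)) borel vec_lambda"
proof (rule lborel_eqI)
  interpret product_sigma_finite "\<lambda>_::'n. lborel :: 'a measure" by standard
  have meas: "(vec_lambda :: ('n \<Rightarrow> 'a) \<Rightarrow> _) \<in> PiM UNIV (\<lambda>_. lborel) \<rightarrow>\<^sub>M borel"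
  proof (subst borel_measurable_euclidean_space, rule ballI)
    fix b :: "'a ^ 'n" assume "b \<in> Basis"
    then show "(\<lambda>x. vec_lambda x \<bullet> b) \<in> borel_measurable (PiM UNIV (\<lambda>_. lborel))"
      by (auto simp: Basis_vec_def inner_axis)
  qed
  fix l u :: "'a ^ 'n" assume le: "\<And>b. b \<in> Basis \<Longrightarrow> l \<bullet> b \<le> u \<bullet> b"
  have le': "l $ i \<bullet> b \<le> u $ i \<bullet> b" if "b \<in> Basis" for i b
    using le[of "axis i b"] that by (auto simp: Basis_vec_def inner_axis)
  have "vec_lambda -` box l u \<inter> space (PiM UNIV (\<lambda>_. lborel)) = PiE UNIV (\<lambda>i. box (l $ i) (u $ i))"
    by (auto simp: space_PiM Basis_vec_def inner_axis PiE_UNIV_domain Pi_iff mem_box)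
  then have "emeasure (distr (PiM UNIV (\<lambda>_. lborel)) borel vec_lambda) (box l u) =
      (\<Prod>i\<in>UNIV. emeasure lborel (box (l $ i) (u $ i)))"
    by (simp add: emeasure_distr meas emeasure_PiM)
  also have "\<dots> = (\<Prod>i\<in>UNIV. ennreal (\<Prod>b\<in>Basis. (u $ i - l $ i) \<bullet> b))"
    using le' by (intro prod.cong refl) (auto simp: emeasure_lborel_box_eq)
  also have "\<dots> = ennreal (\<Prod>i\<in>UNIV. \<Prod>b\<in>Basis. (u $ i - l $ i) \<bullet> b)"
    using le' by (intro prod_ennreal prod_nonneg) (auto simp: inner_diff_left)
  also have "(\<Prod>i\<in>UNIV. \<Prod>b\<in>Basis. (u $ i - l $ i) \<bullet> b) = (\<Prod>b\<in>Basis. (u - l) \<bullet> b)"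
  proof -
    have basis: "(Basis :: ('a ^ 'n) set) = (\<lambda>(i, b). axis i b) ` (UNIV \<times> Basis)"
      by (auto simp: Basis_vec_def)
    have "(\<Prod>b\<in>Basis. (u - l) \<bullet> b) = (\<Prod>(i, b)\<in>UNIV \<times> Basis. (u $ i - l $ i) \<bullet> b)"
      unfolding basis
    proof (subst prod.reindex)
      show "inj_on (\<lambda>(i :: 'n, b :: 'a). axis i b) (UNIV \<times> Basis)"
        by (auto simp: inj_on_def axis_eq_axis nonzero_Basis)
    qed (auto simp: inner_axis intro!: prod.cong)
    then show ?thesis by (simp add: prod.Sigma)
  qed
  finally show "emeasure (distr (PiM UNIV (\<lambda>_. lborel)) borel vec_lambda) (box l u) = (\<Prod>b\<in>Basis. (u - l) \<bullet> b)" .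
qed simp

lemma lborel_complex_eq_pair:
  "(lborel :: complex measure) = distr (lborel \<Otimes>\<^sub>M lborel) borel (\<lambda>(x, y). Complex x y)"
proof (rule lborel_eqI)
  have meas: "(\<lambda>(x, y). Complex x y) \<in> lborel \<Otimes>\<^sub>M lborel \<rightarrow>\<^sub>M borel"
    by (subst borel_measurable_euclidean_space)
       (auto simp: Basis_complex_def inner_complex_def case_prod_beta')
  fix l u :: complex assume *: "\<And>b. b \<in> Basis \<Longrightarrow> l \<bullet> b \<le> u \<bullet> b"
  have le: "Re l \<le> Re u" "Im l \<le> Im u"
    using *[of 1] *[of \<i>] by (auto simp: Basis_complex_def)
  have "(\<lambda>(x, y). Complex x y) -` box l u \<inter> space (lborel \<Otimes>\<^sub>M lborel) = {Re l<..<Re u} \<times> {Im l<..<Im u}"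
    by (auto simp: mem_box Basis_complex_def space_pair_measure)
  then show "emeasure (distr (lborel \<Otimes>\<^sub>M lborel) borel (\<lambda>(x, y). Complex x y)) (box l u) = (\<Prod>b\<in>Basis. (u - l) \<bullet> b)"
    using le by (simp add: emeasure_distr meas lborel.emeasure_pair_measure_Times Basis_complex_def ennreal_mult')
qed simp

lemma emeasure_lborel_translate:
  fixes A :: "real set"
  assumes "A \<in> sets borel"
  shows "emeasure lborel ((\<lambda>x. c + x) -` A) = emeasure lborel A"
proof -
  have "emeasure lborel A = emeasure (distr lborel borel ((+) c)) A" by (simp only: lborel_distr_plus)
  also have "\<dots> = emeasure lborel ((\<lambda>x. c + x) -` A)" using assms by (subst emeasure_distr) auto
  finally show ?thesis ..
qed

lemma measurable_shear:
  fixes a :: real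
  shows "(\<lambda>(x, y). (x + a * y, y)) \<in> lborel \<Otimes>\<^sub>M lborel \<rightarrow>\<^sub>M lborel \<Otimes>\<^sub>M (lborel :: real measure)"
    and "(\<lambda>(x, y). (x, y + a * x)) \<in> lborel \<Otimes>\<^sub>M lborel \<rightarrow>\<^sub>M lborel \<Otimes>\<^sub>M (lborel :: real measure)"
  by measurable

lemma distr_shear:
  fixes a :: real
  defines "L \<equiv> lborel \<Otimes>\<^sub>M lborel :: (real \<times> real) measure"
  shows "distr L L (\<lambda>(x, y). (x + a * y, y)) = L" and "distr L L (\<lambda>(x, y). (x, y + a * x)) = L"
proof -
  let ?X = "\<lambda>(x, y). (x + a * y, y)" and ?Y = "\<lambda>(x, y). (x, y + a * x)"
  have [measurable]: "?X \<in> L \<rightarrow>\<^sub>M L" "?Y \<in> L \<rightarrow>\<^sub>M L"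
    unfolding L_def by (rule measurable_shear)+
  have sp: "space L = UNIV" by (simp add: L_def space_pair_measure)
  have X: "emeasure L (?X -` A) = emeasure L A" and Y: "emeasure L (?Y -` A) = emeasure L A"
    if [measurable]: "A \<in> sets L" for A
  proof -
    have XA: "?X -` A \<in> sets L" "?Y -` A \<in> sets L"
      using measurable_sets[of ?X L L A] measurable_sets[of ?Y L L A] by (auto simp: sp)
    have slice: "(\<lambda>x. (x, y)) -` A \<in> sets borel" "Pair x -` A \<in> sets borel" for x y
      using sets_Pair2[of A lborel lborel y] sets_Pair1[of A lborel lborel x] that by (simp_all add: L_def)
    have "emeasure L (?X -` A) = (\<integral>\<^sup>+y. emeasure lborel ((\<lambda>x. (x, y)) -` (?X -` A)) \<partial>lborel)"
      using XA(1) unfolding L_def by (rule lborel_pair.emeasure_pair_measure_alt2)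
    also have "\<dots> = (\<integral>\<^sup>+y. emeasure lborel ((\<lambda>x. a * y + x) -` ((\<lambda>x. (x, y)) -` A)) \<partial>lborel)"
      by (intro nn_integral_cong arg_cong[where f="emeasure lborel"]) (auto simp: add.commute)
    also have "\<dots> = (\<integral>\<^sup>+y. emeasure lborel ((\<lambda>x. (x, y)) -` A) \<partial>lborel)"
      by (intro nn_integral_cong emeasure_lborel_translate slice)
    also have "\<dots> = emeasure L A"
      using that unfolding L_def by (rule lborel_pair.emeasure_pair_measure_alt2[symmetric])
    finally show "emeasure L (?X -` A) = emeasure L A" .
    have "emeasure L (?Y -` A) = (\<integral>\<^sup>+x. emeasure lborel (Pair x -` (?Y -` A)) \<partial>lborel)"
      using XA(2) unfolding L_def by (rule lborel.emeasure_pair_measure_alt)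
    also have "\<dots> = (\<integral>\<^sup>+x. emeasure lborel ((\<lambda>y. a * x + y) -` (Pair x -` A)) \<partial>lborel)"
      by (intro nn_integral_cong arg_cong[where f="emeasure lborel"]) (auto simp: add.commute)
    also have "\<dots> = (\<integral>\<^sup>+x. emeasure lborel (Pair x -` A) \<partial>lborel)"
      by (intro nn_integral_cong emeasure_lborel_translate slice)
    also have "\<dots> = emeasure L A"
      using that unfolding L_def by (rule lborel.emeasure_pair_measure_alt[symmetric])
    finally show "emeasure L (?Y -` A) = emeasure L A" .
  qed
  show "distr L L ?X = L"
    by (rule measure_eqI) (simp_all add: emeasure_distr sp X)
  show "distr L L ?Y = L"
    by (rule measure_eqI) (simp_all add: emeasure_distr sp Y)
qed

text \<open>
  A rotation by an angle \<open>\<theta>\<close> that is not a multiple of \<open>\<pi>\<close> is a product of three shears, horizontal,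
  vertical and horizontal, with slopes $-\tan(\theta/2)$, $\sin\theta$ and $-\tan(\theta/2)$. Shears preserve
  Lebesgue measure by Fubini's theorem and translation invariance.
\<close>

lemma distr_lborel_rotation:
  assumes "cmod \<omega> = 1" "Im \<omega> \<noteq> 0"
  shows "distr lborel borel (\<lambda>z. \<omega> * z) = (lborel :: complex measure)"
proof -
  let ?L = "lborel \<Otimes>\<^sub>M lborel :: (real \<times> real) measure"
  let ?C = "\<lambda>(x, y). Complex x y"
  \<comment> \<open>This is $\tan(\theta/2)$ for \<open>\<omega> = cis \<theta>\<close>.\<close>
  define t where "t = (1 - Re \<omega>) / Im \<omega>"
  let ?X = "\<lambda>(x, y). (x + (- t) * y, y)" and ?Y = "\<lambda>(x, y). (x, y + Im \<omega> * x)"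
  have X: "?X \<in> ?L \<rightarrow>\<^sub>M ?L" and Y: "?Y \<in> ?L \<rightarrow>\<^sub>M ?L" by (rule measurable_shear)+
  have meas: "?C \<in> ?L \<rightarrow>\<^sub>M borel"
    by (subst borel_measurable_euclidean_space)
       (auto simp: Basis_complex_def inner_complex_def case_prod_beta')
  have one: "(Re \<omega>)\<^sup>2 + (Im \<omega>)\<^sup>2 = 1" using assms(1) by (metis cmod_power2 power_one)
  have shears: "\<omega> * ?C p = ?C (?X (?Y (?X p)))" for p
  proof -
    have 1: "1 - t * Im \<omega> = Re \<omega>" using assms by (simp add: t_def)
    have "t * (1 + Re \<omega>) * Im \<omega> = (1 - Re \<omega>) * (1 + Re \<omega>)" using assms by (simp add: t_def)
    also have "\<dots> = Im \<omega> * Im \<omega>" using one by (simp add: algebra_simps power2_eq_square)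
    finally have 2: "t * (1 + Re \<omega>) = Im \<omega>" using assms by simp
    obtain x y where p: "p = (x, y)" by (cases p)
    have re: "x - t * y - t * (y + Im \<omega> * (x - t * y)) = Re \<omega> * x - Im \<omega> * y"
    proof -
      have "x - t * y - t * (y + Im \<omega> * (x - t * y)) = x * (1 - t * Im \<omega>) - y * (t * (1 + (1 - t * Im \<omega>)))"
        by (simp add: algebra_simps)
      also have "\<dots> = x * Re \<omega> - y * Im \<omega>" by (simp only: 1 2)
      finally show ?thesis by (simp only: mult.commute)
    qed
    have im: "y + Im \<omega> * (x - t * y) = Im \<omega> * x + Re \<omega> * y"
    proof -
      have "y + Im \<omega> * (x - t * y) = Im \<omega> * x + (1 - t * Im \<omega>) * y" by (simp add: algebra_simps)
      then show ?thesis by (simp only: 1)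
    qed
    have "\<omega> * Complex x y = Complex (Re \<omega> * x - Im \<omega> * y) (Im \<omega> * x + Re \<omega> * y)"
      by (simp add: complex_eq_iff)
    also have "\<dots> = Complex (x - t * y - t * (y + Im \<omega> * (x - t * y))) (y + Im \<omega> * (x - t * y))"
      unfolding re unfolding im ..
    finally show ?thesis unfolding p by simp
  qed
  have mult: "(\<lambda>z. \<omega> * z) \<in> borel \<rightarrow>\<^sub>M borel" by simp
  have fold: "distr ?L M (\<lambda>p. h (g p)) = distr ?L M h" if "distr ?L ?L g = ?L" "g \<in> ?L \<rightarrow>\<^sub>M ?L" "h \<in> ?L \<rightarrow>\<^sub>M M"
    for g h and M :: "complex measure"
    using distr_distr[OF that(3,2)] that(1) by (simp only: o_def)
  note CX = measurable_compose[OF X meas]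
  note CXY = measurable_compose[OF Y CX]
  have "distr lborel borel (\<lambda>z. \<omega> * z) = distr (distr ?L borel ?C) borel (\<lambda>z. \<omega> * z)"
    by (simp only: lborel_complex_eq_pair[symmetric])
  also have "\<dots> = distr ?L borel (\<lambda>p. \<omega> * ?C p)"
    by (rule distr_distr[OF mult meas, unfolded o_def])
  also have "\<dots> = distr ?L borel (\<lambda>p. ?C (?X (?Y (?X p))))" by (simp only: shears)
  also have "\<dots> = distr ?L borel (\<lambda>p. ?C (?X (?Y p)))" by (rule fold[OF distr_shear(1) X CXY])
  also have "\<dots> = distr ?L borel (\<lambda>p. ?C (?X p))" by (rule fold[OF distr_shear(2) Y CX])
  also have "\<dots> = distr ?L borel ?C" by (rule fold[OF distr_shear(1) X meas])
  also have "\<dots> = lborel" by (rule lborel_complex_eq_pair[symmetric])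
  finally show ?thesis .
qed

lemma borel_measurable_cnj[measurable]: "cnj \<in> borel_measurable borel"
  by (intro borel_measurable_continuous_onI continuous_intros)

lemma fixed_by_factor:
  fixes x c :: complex
  assumes "x = c * x" "c \<noteq> 1" shows "x = 0"
proof -
  have "(1 - c) * x = 0" unfolding left_diff_distrib using assms(1) by auto
  then show ?thesis using assms(2) by auto
qed

text \<open>
  Rotating by \<open>\<omega>\<close> multiplies the integral by $\omega^a \overline{\omega}^b$, which differs from 1 for a suitable
  \<open>\<omega>\<close>. For a non-integrable integrand the integral has the default value 0.
\<close>

lemma integral_angular_zero:
  fixes g :: "real \<Rightarrow> complex"
  assumes [measurable]: "g \<in> borel_measurable borel" and "a \<noteq> b"
  shows "(\<integral>z. g (cmod z) * z ^ a * cnj z ^ b \<partial>lborel) = 0"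
proof -
  define d where "d = real a - real b"
  \<comment> \<open>With this angle $\omega^a \overline{\omega}^b$ is \<open>\<i>\<close> or \<open>- \<i>\<close>, and \<open>\<omega>\<close> is not real, as the shears require.\<close>
  define \<omega> where "\<omega> = cis (pi / 2 / \<bar>d\<bar>)"
  have d: "1 \<le> \<bar>d\<bar>" using assms unfolding d_def by linarith
  have "0 < pi / 2 / \<bar>d\<bar>" "pi / 2 / \<bar>d\<bar> < pi" using d by (auto simp: field_simps)
  then have im: "Im \<omega> \<noteq> 0" by (simp add: \<omega>_def sin_gt_zero less_imp_neq[symmetric])
  have norm: "cmod \<omega> = 1" by (simp add: \<omega>_def)
  have "\<omega> ^ a * cnj \<omega> ^ b = cis (pi / 2 / \<bar>d\<bar> * d)"
    by (simp add: \<omega>_def Complex.DeMoivre cis_cnj cis_mult d_def algebra_simps diff_divide_distrib)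
  moreover have "cis (pi / 2 / \<bar>d\<bar> * d) \<in> {\<i>, - \<i>}"
  proof (cases "0 < d")
    case True
    then have "pi / 2 / \<bar>d\<bar> * d = pi / 2" by simp
    then show ?thesis by (simp only: cis_pi_half) simp
  next
    case False
    then have "pi / 2 / \<bar>d\<bar> * d = - (pi / 2)" using d by simp
    then show ?thesis by (simp only: cis_minus_pi_half) simp
  qed
  ultimately have "\<omega> ^ a * cnj \<omega> ^ b \<in> {\<i>, - \<i>}" by simp
  then have ne: "\<omega> ^ a * cnj \<omega> ^ b \<noteq> 1" by (auto simp: complex_eq_iff)
  let ?G = "\<lambda>z. g (cmod z) * z ^ a * cnj z ^ b"
  have [measurable]: "?G \<in> borel_measurable borel" by measurable
  have "integral\<^sup>L lborel ?G = (\<integral>z. ?G z \<partial>distr lborel borel (\<lambda>z. \<omega> * z))"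
    by (simp only: distr_lborel_rotation[OF norm im])
  also have "\<dots> = (\<integral>z. ?G (\<omega> * z) \<partial>lborel)"
    by (rule integral_distr) auto
  also have "\<dots> = (\<integral>z. (\<omega> ^ a * cnj \<omega> ^ b) * ?G z \<partial>lborel)"
    by (rule Bochner_Integration.integral_cong[OF refl]) (simp only: norm_mult norm power_mult_distrib complex_cnj_mult mult_1_left mult_ac)
  also have "\<dots> = (\<omega> ^ a * cnj \<omega> ^ b) * integral\<^sup>L lborel ?G"
    by (rule integral_mult_right_zero)
  finally have eq: "integral\<^sup>L lborel ?G = (\<omega> ^ a * cnj \<omega> ^ b) * integral\<^sup>L lborel ?G" .
  show ?thesis by (rule fixed_by_factor[OF eq ne])
qed

section \<open>Radial parts of Gaussian weights on the complex plane\<close>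

text \<open>
  Polar coordinates for functions of the modulus: the disc of radius \<open>r\<close> has area $\pi r^2$, whose
  derivative is $2 \pi r$.
\<close>

lemma distr_cmod:
  "distr lborel borel cmod = density lborel (\<lambda>r. ennreal (if 0 < r then 2 * pi * r else 0))" (is "?L = ?R")
proof (rule measure_eqI_generator_eq[where E="range atMost" and \<Omega>=UNIV and A="\<lambda>n. {..real n}"])
  show "Int_stable (range (atMost :: real \<Rightarrow> _))"
    by (auto simp: Int_stable_def)
  show "sets ?L = sigma_sets UNIV (range atMost)" "sets ?R = sigma_sets UNIV (range atMost)"
    by (simp_all add: borel_eq_atMost)
  have L: "emeasure ?L {..r} = ennreal (if 0 \<le> r then pi * r\<^sup>2 else 0)" for r
  proof -
    have "emeasure ?L {..r} = emeasure lborel (cball (0::complex) r)"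
      by (subst emeasure_distr) (auto intro!: arg_cong[where f="emeasure lborel"])
    then show ?thesis by (simp add: emeasure_cball unit_ball_vol_2)
  qed
  have R: "emeasure ?R {..r} = ennreal (if 0 \<le> r then pi * r\<^sup>2 else 0)" for r
  proof (cases "0 \<le> r")
    case True
    have "emeasure ?R {..r} = (\<integral>\<^sup>+x. ennreal (if 0 < x then 2 * pi * x else 0) * indicator {..r} x \<partial>lborel)"
      by (subst emeasure_density) auto
    also have "\<dots> = (\<integral>\<^sup>+x. ennreal (2 * pi * x) * indicator {0..r} x \<partial>lborel)"
      by (intro nn_integral_cong) (auto simp: indicator_def ennreal_neg)
    also have "\<dots> = ennreal (pi * r\<^sup>2 - pi * 0\<^sup>2)"
      using True by (intro nn_integral_FTC_Icc[where F="\<lambda>x. pi * x\<^sup>2"]) (auto intro!: derivative_eq_intros)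
    finally show ?thesis using True by simp
  next
    case False
    then have "(\<integral>\<^sup>+x. ennreal (if 0 < x then 2 * pi * x else 0) * indicator {..r} x \<partial>lborel) = (\<integral>\<^sup>+(x::real). 0 \<partial>lborel)"
      by (intro nn_integral_cong) (auto simp: indicator_def)
    then show ?thesis using False by (subst emeasure_density) auto
  qed
  show "emeasure ?L X = emeasure ?R X" if "X \<in> range atMost" for X
    using that by (auto simp: L R)
  show "range (\<lambda>n. {..real n}) \<subseteq> range atMost" "range (atMost :: real \<Rightarrow> _) \<subseteq> Pow UNIV" by auto
  show "(\<Union>n. {..real n}) = UNIV" by (auto intro: real_arch_simple)
  show "emeasure ?L {..real n} \<noteq> \<infinity>" for n by (simp add: L)
qed

definition planar_density :: "real \<Rightarrow> nat \<Rightarrow> real \<Rightarrow> real" where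
  "planar_density N a r = r ^ (2 * a) * exp (- N * r\<^sup>2)"

text \<open>
  The angular integral contributes the $2\pi$ of the normalisation and the radial one the mass of the
  radial weight.
\<close>

definition planar_law :: "real \<Rightarrow> nat \<Rightarrow> complex measure" where
  "planar_law N a = density lborel (\<lambda>z. ennreal (planar_density N a (cmod z) / (2 * pi * radial_mass N a)))"

lemma planar_density_nonneg: "0 \<le> planar_density N a r"
  by (simp add: planar_density_def power_mult)

lemma planar_density_measurable[measurable]: "planar_density N a \<in> borel_measurable borel"
  unfolding planar_density_def by measurable

lemma sets_planar_law[measurable_cong, simp]: "sets (planar_law N a) = sets borel"
  and space_planar_law[simp]: "space (planar_law N a) = UNIV"
  by (simp_all add: planar_law_def)

lemma distr_planar_law:
  assumes "0 < N"
  shows "distr (planar_law N a) borel cmod = radial_law N a"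
proof -
  let ?Z = "radial_mass N a"
  let ?w = "\<lambda>r. ennreal (planar_density N a r / (2 * pi * ?Z))"
  have Z: "0 < ?Z" by (rule radial_mass_pos[OF assms])
  have "distr (planar_law N a) borel cmod = density (distr lborel borel cmod) ?w"
    unfolding planar_law_def by (rule density_distr[symmetric]) auto
  also have "\<dots> = density lborel (\<lambda>r. ennreal (if 0 < r then 2 * pi * r else 0) * ?w r)"
    unfolding distr_cmod by (rule density_density_eq) auto
  also have "\<dots> = radial_law N a"
    unfolding radial_law_def
  proof (rule density_cong)
    show "AE r in lborel. ennreal (if 0 < r then 2 * pi * r else 0) * ?w r = ennreal (radial_weight N a r / ?Z)"
      using Z by (auto simp: radial_weight_def planar_density_def ennreal_mult'[symmetric] field_simps)
  qed auto
  finally show ?thesis .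
qed

lemma prob_space_planar_law:
  assumes "0 < N" shows "prob_space (planar_law N a)"
proof (rule prob_space_distrD[of cmod _ borel])
  show "prob_space (distr (planar_law N a) borel cmod)"
    unfolding distr_planar_law[OF assms] by (rule prob_space_radial_law[OF assms])
qed simp

lemma integrable_planar_density:
  assumes "0 < N" shows "integrable lborel (\<lambda>z. planar_density N a (cmod z))"
proof -
  interpret prob_space "planar_law N a" by (rule prob_space_planar_law[OF assms])
  have "integrable (planar_law N a) (\<lambda>_. 1 :: real)" by simp
  then have "integrable lborel (\<lambda>z. planar_density N a (cmod z) / (2 * pi * radial_mass N a))"
    unfolding planar_law_def
    by (subst (asm) integrable_real_density)
       (use radial_mass_pos[OF assms, of a] planar_density_nonneg in \<open>auto simp: less_imp_le\<close>)
  from integrable_mult_right[OF this, of "2 * pi * radial_mass N a"] show ?thesis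
    using radial_mass_pos[OF assms, of a] by simp
qed

lemma PiM_planar_law:
  fixes a :: "'i::finite \<Rightarrow> nat"
  assumes "0 < N"
  shows "PiM UNIV (\<lambda>i. planar_law N (a i)) = density (PiM UNIV (\<lambda>_. lborel))
    (\<lambda>x. ennreal (\<Prod>i\<in>UNIV. planar_density N (a i) (cmod (x i)) / (2 * pi * radial_mass N (a i))))"
    (is "_ = density ?L (\<lambda>x. ennreal (\<Prod>i\<in>UNIV. ?w i (x i)))")
proof (rule sym, rule product_sigma_finite.PiM_eqI)
  interpret L: product_sigma_finite "\<lambda>_::'i. lborel :: complex measure" by standard
  interpret P: product_prob_space "\<lambda>i. planar_law N (a i)" UNIV
    by (rule product_prob_spaceI) (rule prob_space_planar_law[OF assms])
  show "product_sigma_finite (\<lambda>i. planar_law N (a i))" by unfold_locales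
  show "sets (density ?L (\<lambda>x. ennreal (\<Prod>i\<in>UNIV. ?w i (x i)))) = sets (PiM UNIV (\<lambda>i. planar_law N (a i)))"
    by (simp cong: sets_PiM_cong)
  have w: "0 \<le> ?w i z" for i z
    using radial_mass_pos[OF assms, of "a i"] planar_density_nonneg[of N "a i" "cmod z"] by simp
  have [measurable]: "?w i \<in> borel_measurable borel" for i by measurable
  fix A :: "'i \<Rightarrow> complex set" assume "\<And>i. i \<in> UNIV \<Longrightarrow> A i \<in> sets (planar_law N (a i))"
  then have A[measurable]: "A i \<in> sets borel" for i by simp
  have "Pi\<^sub>E UNIV A \<in> sets ?L" by (intro sets_PiM_I_finite) auto
  then have "emeasure (density ?L (\<lambda>x. ennreal (\<Prod>i\<in>UNIV. ?w i (x i)))) (Pi\<^sub>E UNIV A)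
      = (\<integral>\<^sup>+x. ennreal (\<Prod>i\<in>UNIV. ?w i (x i)) * indicator (Pi\<^sub>E UNIV A) x \<partial>?L)"
    by (intro emeasure_density) auto
  also have "\<dots> = (\<integral>\<^sup>+x. (\<Prod>i\<in>UNIV. ennreal (?w i (x i)) * indicator (A i) (x i)) \<partial>?L)"
  proof (intro nn_integral_cong)
    fix x :: "'i \<Rightarrow> complex"
    have "indicator (Pi\<^sub>E UNIV A) x = (\<Prod>i\<in>UNIV. indicator (A i) (x i) :: ennreal)"
      by (auto simp: indicator_def PiE_iff)
    then show "ennreal (\<Prod>i\<in>UNIV. ?w i (x i)) * indicator (Pi\<^sub>E UNIV A) x
        = (\<Prod>i\<in>UNIV. ennreal (?w i (x i)) * indicator (A i) (x i))"
      using w by (simp only: prod.distrib prod_ennreal)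
  qed
  also have "\<dots> = (\<Prod>i\<in>UNIV. \<integral>\<^sup>+z. ennreal (?w i z) * indicator (A i) z \<partial>lborel)"
    by (rule L.product_nn_integral_prod) auto
  also have "\<dots> = (\<Prod>i\<in>UNIV. emeasure (planar_law N (a i)) (A i))"
    unfolding planar_law_def by (intro prod.cong refl emeasure_density[symmetric]) auto
  finally show "emeasure (density ?L (\<lambda>x. ennreal (\<Prod>i\<in>UNIV. ?w i (x i)))) (Pi\<^sub>E UNIV A)
      = (\<Prod>i\<in>UNIV. emeasure (planar_law N (a i)) (A i))" .
qed simp

lemma measurable_cmod_PiM:
  fixes M :: "complex measure"
  assumes "sets M = sets borel"
  shows "(\<lambda>x i. cmod (x i)) \<in> PiM UNIV (\<lambda>_. M) \<rightarrow>\<^sub>M PiM UNIV (\<lambda>_::'i::finite. borel)"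
proof (rule measurable_PiM_single')
  show "(\<lambda>x. cmod (x i)) \<in> PiM UNIV (\<lambda>_. M) \<rightarrow>\<^sub>M borel" for i :: 'i
    by (rule measurable_compose[OF measurable_component_singleton[OF UNIV_I]])
       (simp add: measurable_cong_sets[OF assms refl])
qed auto

text \<open>
  Under the product of the laws \<open>planar_law N (a i)\<close> the moduli are independent with laws
  \<open>radial_law N (a i)\<close>.
\<close>

lemma integral_radial_PiM:
  fixes a :: "'i::finite \<Rightarrow> nat" and \<Phi> :: "('i \<Rightarrow> real) \<Rightarrow> real"
  assumes N: "0 < N" and [measurable]: "\<Phi> \<in> borel_measurable (PiM UNIV (\<lambda>_. borel))"
  shows "(\<integral>x. \<Phi> (\<lambda>i. cmod (x i)) * (\<Prod>i\<in>UNIV. planar_density N (a i) (cmod (x i))) \<partial>PiM UNIV (\<lambda>_. lborel))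
    = (\<Prod>i\<in>UNIV. 2 * pi * radial_mass N (a i)) * (\<integral>r. \<Phi> r \<partial>PiM UNIV (\<lambda>i. radial_law N (a i)))"
proof -
  let ?P = "PiM UNIV (\<lambda>i. planar_law N (a i))" and ?R = "PiM UNIV (\<lambda>i. radial_law N (a i))"
  let ?c = "\<Prod>i\<in>UNIV. 2 * pi * radial_mass N (a i)"
  have c: "0 < ?c" using radial_mass_pos[OF N] by (intro prod_pos) auto
  have "distr ?P ?R (compose UNIV cmod) = PiM UNIV (\<lambda>i. distr (planar_law N (a i)) (radial_law N (a i)) cmod)"
    by (rule distr_PiM_finite_prob_space')
       (auto simp: prob_space_planar_law prob_space_radial_law N)
  also have "\<dots> = ?R"
    by (intro PiM_cong refl) (simp add: distr_planar_law[OF N, symmetric] cong: distr_cong)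
  finally have push: "distr ?P ?R (compose UNIV cmod) = ?R" .
  have comp: "compose UNIV cmod x = (\<lambda>i. cmod (x i))" for x :: "'i \<Rightarrow> complex"
    by (rule ext) (simp add: compose_def)
  have push_meas: "(\<lambda>x i. cmod (x i)) \<in> ?P \<rightarrow>\<^sub>M ?R"
    using measurable_cmod_PiM[OF refl] by (simp cong: measurable_cong_sets sets_PiM_cong)
  have Phi: "\<Phi> \<in> borel_measurable ?R" by (simp cong: measurable_cong_sets sets_PiM_cong)
  have m: "(\<lambda>x. \<Phi> (\<lambda>i. cmod (x i))) \<in> borel_measurable (PiM UNIV (\<lambda>_. lborel))"
    by (rule measurable_compose[OF measurable_cmod_PiM[OF sets_lborel] assms(2)])
  have nn: "0 \<le> (\<Prod>i\<in>UNIV. planar_density N (a i) (cmod (x i)) / (2 * pi * radial_mass N (a i)))" for x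
    using radial_mass_pos[OF N] planar_density_nonneg by (intro prod_nonneg) (auto simp: less_imp_le)
  have "(\<integral>r. \<Phi> r \<partial>?R) = (\<integral>r. \<Phi> r \<partial>distr ?P ?R (compose UNIV cmod))" by (simp only: push)
  also have "\<dots> = (\<integral>x. \<Phi> (\<lambda>i. cmod (x i)) \<partial>?P)"
    unfolding comp[abs_def] by (rule integral_distr[OF push_meas Phi])
  also have "\<dots> = (\<integral>x. (\<Prod>i\<in>UNIV. planar_density N (a i) (cmod (x i)) / (2 * pi * radial_mass N (a i))) *
      \<Phi> (\<lambda>i. cmod (x i)) \<partial>PiM UNIV (\<lambda>_. lborel))"
    unfolding PiM_planar_law[OF N] by (rule integral_real_density) (use nn m in auto)
  also have "\<dots> = (\<integral>x. 1 / ?c * (\<Phi> (\<lambda>i. cmod (x i)) * (\<Prod>i\<in>UNIV. planar_density N (a i) (cmod (x i)))) \<partial>PiM UNIV (\<lambda>_. lborel))"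
    by (simp add: prod_dividef mult_ac)
  also have "\<dots> = 1 / ?c * (\<integral>x. \<Phi> (\<lambda>i. cmod (x i)) * (\<Prod>i\<in>UNIV. planar_density N (a i) (cmod (x i))) \<partial>PiM UNIV (\<lambda>_. lborel))"
    by (rule integral_mult_right_zero)
  finally have *: "(\<integral>r. \<Phi> r \<partial>?R) =
    1 / ?c * (\<integral>x. \<Phi> (\<lambda>i. cmod (x i)) * (\<Prod>i\<in>UNIV. planar_density N (a i) (cmod (x i))) \<partial>PiM UNIV (\<lambda>_. lborel))" .
  have "x = b * (1 / b * x)" if "0 < b" for b x :: real using that by simp
  from this[OF c] show ?thesis unfolding * .
qed

section \<open>The moduli of the Ginibre points under symmetric observables\<close>

text \<open>
  The one-coordinate factors that occur in \<open>ginibre_weight_expansion\<close>.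
\<close>

definition planar_monomial :: "real \<Rightarrow> nat \<Rightarrow> nat \<Rightarrow> complex \<Rightarrow> complex" where
  "planar_monomial N a b z = z ^ a * cnj z ^ b * of_real (exp (- N * (cmod z)\<^sup>2))"

lemma planar_monomial_measurable[measurable]: "planar_monomial N a b \<in> borel_measurable borel"
  unfolding planar_monomial_def by measurable

lemma planar_monomial_diag: "planar_monomial N a a z = of_real (planar_density N a (cmod z))"
proof -
  have "z ^ a * cnj z ^ a = of_real (cmod z ^ (2 * a))"
    by (metis complex_norm_square of_real_power power_mult power_mult_distrib)
  then show ?thesis by (simp add: planar_monomial_def planar_density_def)
qed

lemma integrable_planar_monomial:
  assumes "0 < N" shows "integrable lborel (planar_monomial N a b)"
proof (rule Bochner_Integration.integrable_bound)
  show "integrable lborel (\<lambda>z. planar_density N a (cmod z) + planar_density N b (cmod z))"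
    by (intro Bochner_Integration.integrable_add integrable_planar_density assms)
  have "cmod (planar_monomial N a b z) \<le> planar_density N a (cmod z) + planar_density N b (cmod z)" for z
  proof -
    let ?r = "cmod z"
    have "cmod (planar_monomial N a b z) = (?r ^ a * ?r ^ b) * exp (- N * ?r\<^sup>2)"
      by (simp add: planar_monomial_def norm_mult norm_power)
    also have "\<dots> \<le> ((?r ^ a)\<^sup>2 + (?r ^ b)\<^sup>2) * exp (- N * ?r\<^sup>2)"
    proof (rule mult_right_mono)
      have "0 \<le> ?r ^ a * ?r ^ b" by simp
      moreover have "2 * (?r ^ a * ?r ^ b) \<le> (?r ^ a)\<^sup>2 + (?r ^ b)\<^sup>2"
        using sum_squares_bound[of "?r ^ a" "?r ^ b"] by simp
      ultimately show "?r ^ a * ?r ^ b \<le> (?r ^ a)\<^sup>2 + (?r ^ b)\<^sup>2" by linarith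
    qed simp
    finally show ?thesis
      by (simp add: planar_density_def algebra_simps power_mult[symmetric])
  qed
  then show "AE z in lborel. norm (planar_monomial N a b z) \<le> norm (planar_density N a (cmod z) + planar_density N b (cmod z))"
    using planar_density_nonneg by (auto simp: abs_of_nonneg)
qed simp

context
  fixes N :: real
  assumes N: "0 < N"
begin

interpretation L: product_sigma_finite "\<lambda>_::'i::finite. lborel :: complex measure" by standard

lemma integrable_radial_monomials:
  fixes \<Phi> :: "('i::finite \<Rightarrow> real) \<Rightarrow> real" and a b :: "'i \<Rightarrow> nat"
  assumes "\<Phi> \<in> borel_measurable (PiM UNIV (\<lambda>_. borel))" and "\<And>r. \<bar>\<Phi> r\<bar> \<le> B"
  shows "integrable (PiM UNIV (\<lambda>_. lborel))
    (\<lambda>x. of_real (\<Phi> (\<lambda>i. cmod (x i))) * (\<Prod>i\<in>UNIV. planar_monomial N (a i) (b i) (x i)))"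
proof (rule Bochner_Integration.integrable_bound)
  have prod: "integrable (PiM UNIV (\<lambda>_::'i. lborel)) (\<lambda>x. \<Prod>i\<in>UNIV. planar_monomial N (a i) (b i) (x i))"
    by (rule L.product_integrable_prod) (auto intro: integrable_planar_monomial N)
  then show "integrable (PiM UNIV (\<lambda>_::'i. lborel)) (\<lambda>x. of_real B * (\<Prod>i\<in>UNIV. planar_monomial N (a i) (b i) (x i)))"
    by simp
  have "(\<lambda>x. \<Phi> (\<lambda>i. cmod (x i))) \<in> borel_measurable (PiM UNIV (\<lambda>_. lborel))"
    by (rule measurable_compose[OF measurable_cmod_PiM[OF sets_lborel] assms(1)])
  then show "(\<lambda>x. of_real (\<Phi> (\<lambda>i. cmod (x i))) * (\<Prod>i\<in>UNIV. planar_monomial N (a i) (b i) (x i)))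
      \<in> borel_measurable (PiM UNIV (\<lambda>_. lborel))"
    by measurable
  have B: "0 \<le> B" using assms(2)[of undefined] by linarith
  show "AE x in PiM UNIV (\<lambda>_. lborel). norm (of_real (\<Phi> (\<lambda>i. cmod (x i))) * (\<Prod>i\<in>UNIV. planar_monomial N (a i) (b i) (x i)))
      \<le> norm (of_real B * (\<Prod>i\<in>UNIV. planar_monomial N (a i) (b i) (x i)))"
    by (intro AE_I2) (auto simp only: norm_mult norm_of_real abs_of_nonneg[OF B] intro!: mult_right_mono assms(2) norm_ge_zero)
qed

text \<open>
  Integrate first over a coordinate in which the exponents differ. The other moduli being fixed, the
  integrand is a function of the modulus times a nontrivial character of the angle.
\<close>

lemma integral_radial_monomials_offdiag:
  fixes \<Phi> :: "('i::finite \<Rightarrow> real) \<Rightarrow> real" and a b :: "'i \<Rightarrow> nat"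
  assumes \<Phi>[measurable]: "\<Phi> \<in> borel_measurable (PiM UNIV (\<lambda>_. borel))" and bound: "\<And>r. \<bar>\<Phi> r\<bar> \<le> B"
    and "a \<noteq> b"
  shows "(\<integral>x. of_real (\<Phi> (\<lambda>i. cmod (x i))) * (\<Prod>i\<in>UNIV. planar_monomial N (a i) (b i) (x i))
    \<partial>PiM UNIV (\<lambda>_. lborel)) = 0"
proof -
  obtain i where i: "a i \<noteq> b i" using assms(3) by auto
  let ?G = "\<lambda>x. of_real (\<Phi> (\<lambda>i. cmod (x i))) * (\<Prod>i\<in>UNIV. planar_monomial N (a i) (b i) (x i))"
  have ins: "insert i (UNIV - {i}) = UNIV" by auto
  have eq: "integral\<^sup>L (PiM UNIV (\<lambda>_. lborel)) ?G
      = (\<integral>x. (\<integral>z. ?G (x(i := z)) \<partial>lborel) \<partial>PiM (UNIV - {i}) (\<lambda>_. lborel))"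
    using L.product_integral_insert[of "UNIV - {i}" i ?G] integrable_radial_monomials[OF \<Phi> bound, of a b]
    by (simp add: ins)
  have zero: "(\<integral>z. ?G (x(i := z)) \<partial>lborel) = 0" for x
  proof -
    \<comment> \<open>The factors that do not involve the coordinate \<open>i\<close> are constants of the inner integral.\<close>
    define P where "P = (\<Prod>j\<in>UNIV - {i}. planar_monomial N (a j) (b j) (x j))"
    define g where "g r = of_real (\<Phi> ((\<lambda>j. cmod (x j))(i := r)) * exp (- N * r\<^sup>2)) * P" for r
    have "(\<lambda>r. (\<lambda>j. cmod (x j))(i := r)) \<in> borel \<rightarrow>\<^sub>M PiM UNIV (\<lambda>_::'i. borel)"
      by (rule measurable_PiM_single') auto
    from measurable_compose[OF this \<Phi>] have [measurable]: "g \<in> borel_measurable borel"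
      unfolding g_def by measurable
    have "?G (x(i := z)) = g (cmod z) * z ^ a i * cnj z ^ b i" for z
    proof -
      have "(\<Prod>j\<in>UNIV. planar_monomial N (a j) (b j) ((x(i := z)) j)) = planar_monomial N (a i) (b i) z * P"
        unfolding P_def by (subst prod.remove[of _ i]) (auto intro!: prod.cong)
      moreover have "(\<lambda>j. cmod ((x(i := z)) j)) = (\<lambda>j. cmod (x j))(i := cmod z)" by auto
      ultimately show ?thesis
        by (simp only: g_def planar_monomial_def of_real_mult mult_ac)
    qed
    then show ?thesis using integral_angular_zero[of g "a i" "b i"] i by simp
  qed
  show ?thesis unfolding eq by (simp only: zero Bochner_Integration.integral_zero)
qed

end

lemma measurable_vec_lambda:
  "vec_lambda \<in> PiM UNIV (\<lambda>_::'n::finite. borel) \<rightarrow>\<^sub>M (borel :: ('a::euclidean_space ^ 'n) measure)"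
proof (subst borel_measurable_euclidean_space, rule ballI)
  fix b :: "'a ^ 'n" assume "b \<in> Basis"
  then show "(\<lambda>x. vec_lambda x \<bullet> b) \<in> borel_measurable (PiM UNIV (\<lambda>_. borel))"
    by (auto simp: Basis_vec_def inner_axis)
qed

lemma integral_PiM_radial_permute:
  fixes F :: "real ^ 'n::finite \<Rightarrow> real"
  assumes N: "0 < N" and F: "F \<in> borel_measurable borel" and sym: "symmetric F" and p: "p permutes UNIV"
  shows "(\<integral>r. F (vec_lambda r) \<partial>PiM UNIV (\<lambda>i. radial_law N (a (p i)))) = (\<integral>r. F (vec_lambda r) \<partial>PiM UNIV (\<lambda>i. radial_law N (a i)))"
proof -
  let ?M = "PiM UNIV (\<lambda>i. radial_law N (a i))" and ?M' = "PiM UNIV (\<lambda>i. radial_law N (a (p i)))"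
  have m: "(\<lambda>r. F (vec_lambda r)) \<in> borel_measurable ?M'"
    using measurable_compose[OF measurable_vec_lambda F] by (simp cong: measurable_cong_sets sets_PiM_cong)
  have "distr ?M ?M' (\<lambda>\<omega>. \<lambda>n\<in>UNIV. \<omega> (p n)) = ?M'"
    by (rule distr_PiM_reindex) (use p in \<open>auto simp: prob_space_radial_law[OF N] permutes_inj\<close>)
  moreover have "(\<lambda>n\<in>UNIV. \<omega> (p n)) = (\<lambda>n. \<omega> (p n))" for \<omega> :: "'n \<Rightarrow> real"
    by (rule ext) simp
  ultimately have push: "distr ?M ?M' (\<lambda>\<omega> n. \<omega> (p n)) = ?M'" by simp
  have pm: "(\<lambda>\<omega> n. \<omega> (p n)) \<in> ?M \<rightarrow>\<^sub>M ?M'"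
    by (rule measurable_PiM_single') (auto intro: measurable_component_singleton)
  have "(\<integral>r. F (vec_lambda r) \<partial>?M') = (\<integral>r. F (vec_lambda r) \<partial>distr ?M ?M' (\<lambda>\<omega> n. \<omega> (p n)))"
    by (simp only: push)
  also have "\<dots> = (\<integral>r. F (\<chi> n. r (p n)) \<partial>?M)"
    by (rule integral_distr[OF pm m])
  also have "\<dots> = (\<integral>r. F (vec_lambda r) \<partial>?M)"
  proof (rule Bochner_Integration.integral_cong[OF refl])
    fix r :: "'n \<Rightarrow> real"
    have "F (\<chi> i. vec_lambda r $ p i) = F (vec_lambda r)"
      using sym permutes_bij[OF p] unfolding symmetric_def by blast
    then show "F (\<chi> n. r (p n)) = F (vec_lambda r)" by simp
  qed
  finally show ?thesis .
qed

lemma ginibre_weight_measurable[measurable]: "ginibre_weight \<in> borel_measurable borel"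
  unfolding ginibre_weight_def[abs_def]
  by (intro borel_measurable_continuous_onI continuous_intros) (auto simp: case_prod_beta' intro!: continuous_intros)

text \<open>
  Only the diagonal terms \<open>p = q\<close> of the expanded weight contribute, with sign $\mathrm{sgn}(p)^2 = 1$, and
  they are all equal because permuting the laws of the coordinates does not change the integral of a
  symmetric function. Hence the factor $n!$.
\<close>

lemma integral_ginibre_weight_radial:
  fixes F :: "(real, 'n::{finite,linorder}) vec \<Rightarrow> real"
  assumes F: "F \<in> borel_measurable borel" and sym: "symmetric F" and bound: "\<And>r. \<bar>F r\<bar> \<le> B"
  shows "(\<integral>z. F (\<chi> i. cmod (z $ i)) * ginibre_weight z \<partial>lborel) =
    real (fact CARD('n)) * (\<Prod>i\<in>(UNIV :: 'n set). 2 * pi * radial_mass (real CARD('n)) (rank_of i)) *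
    (\<integral>r. F (vec_lambda r) \<partial>PiM UNIV (\<lambda>i. radial_law (real CARD('n)) (rank_of i)))"
proof -
  let ?N = "real CARD('n)"
  let ?L = "PiM UNIV (\<lambda>_::'n. lborel :: complex measure)"
  let ?Perm = "{p. p permutes (UNIV :: 'n set)}"
  let ?I = "\<integral>r. F (vec_lambda r) \<partial>PiM UNIV (\<lambda>i::'n. radial_law ?N (rank_of i))"
  let ?Z = "\<Prod>i\<in>(UNIV :: 'n set). 2 * pi * radial_mass ?N (rank_of i)"
  have N: "0 < ?N" by simp
  define \<Phi> where "\<Phi> = (\<lambda>r :: 'n \<Rightarrow> real. F (vec_lambda r))"
  have \<Phi>: "\<Phi> \<in> borel_measurable (PiM UNIV (\<lambda>_. borel))"
    unfolding \<Phi>_def by (rule measurable_compose[OF measurable_vec_lambda F])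
  have \<Phi>b: "\<And>r. \<bar>\<Phi> r\<bar> \<le> B" by (simp add: \<Phi>_def bound)
  define T where "T p q x = of_real (\<Phi> (\<lambda>i. cmod (x i))) *
      (\<Prod>i\<in>UNIV. planar_monomial ?N (rank_of (p i)) (rank_of (q i)) (x i))" for p q :: "'n \<Rightarrow> 'n" and x :: "'n \<Rightarrow> complex"
  have T_int: "integrable ?L (T p q)" for p q
    unfolding T_def by (rule integrable_radial_monomials[OF N \<Phi> \<Phi>b])
  have T_off: "integral\<^sup>L ?L (T p q) = 0" if "p \<noteq> q" for p q
    unfolding T_def
  proof (rule integral_radial_monomials_offdiag[OF N \<Phi> \<Phi>b])
    show "(\<lambda>i. rank_of (p i)) \<noteq> (\<lambda>i. rank_of (q i))"
      using that inj_rank_of by (auto simp: fun_eq_iff inj_def)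
  qed
  have T_diag: "integral\<^sup>L ?L (T p p) = of_real (?Z * ?I)" if p: "p permutes UNIV" for p
  proof -
    have "integral\<^sup>L ?L (T p p) = (\<integral>x. of_real (\<Phi> (\<lambda>i. cmod (x i)) * (\<Prod>i\<in>UNIV. planar_density ?N (rank_of (p i)) (cmod (x i)))) \<partial>?L)"
      by (simp add: T_def[abs_def] planar_monomial_diag)
    also have "\<dots> = of_real (\<integral>x. \<Phi> (\<lambda>i. cmod (x i)) * (\<Prod>i\<in>UNIV. planar_density ?N (rank_of (p i)) (cmod (x i))) \<partial>?L)"
      by (rule integral_complex_of_real)
    also have "(\<integral>x. \<Phi> (\<lambda>i. cmod (x i)) * (\<Prod>i\<in>UNIV. planar_density ?N (rank_of (p i)) (cmod (x i))) \<partial>?L)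
        = (\<Prod>i\<in>UNIV. 2 * pi * radial_mass ?N (rank_of (p i))) * (\<integral>r. \<Phi> r \<partial>PiM UNIV (\<lambda>i. radial_law ?N (rank_of (p i))))"
      by (rule integral_radial_PiM[OF N \<Phi>])
    also have "(\<integral>r. \<Phi> r \<partial>PiM UNIV (\<lambda>i. radial_law ?N (rank_of (p i)))) = ?I"
      unfolding \<Phi>_def by (rule integral_PiM_radial_permute[OF N F sym p])
    also have "(\<Prod>i\<in>UNIV. 2 * pi * radial_mass ?N (rank_of (p i))) = ?Z"
      using prod.permute[OF p, of "\<lambda>i. 2 * pi * radial_mass ?N (rank_of i)"] by (simp only: o_def)
    finally show ?thesis .
  qed
  have vm: "vec_lambda \<in> ?L \<rightarrow>\<^sub>M borel"
    using measurable_vec_lambda by (simp cong: measurable_cong_sets sets_PiM_cong)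
  have Fm: "(\<lambda>z. F (\<chi> i. cmod (z $ i)) * ginibre_weight z) \<in> borel_measurable borel"
  proof -
    have "(\<lambda>z. \<chi> i. cmod (z $ i)) \<in> borel_measurable (borel :: ((complex, 'n) vec) measure)"
      by (intro borel_measurable_continuous_onI continuous_intros)
    from measurable_compose[OF this F] show ?thesis by measurable
  qed
  have "complex_of_real (\<integral>z. F (\<chi> i. cmod (z $ i)) * ginibre_weight z \<partial>lborel)
      = complex_of_real (\<integral>x. F (\<chi> i. cmod (vec_lambda x $ i)) * ginibre_weight (vec_lambda x) \<partial>?L)"
    by (subst lborel_vec_eq_PiM, subst integral_distr[OF vm Fm]) (rule refl)
  also have "\<dots> = (\<integral>x. complex_of_real (F (\<chi> i. cmod (vec_lambda x $ i)) * ginibre_weight (vec_lambda x)) \<partial>?L)"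
    by (rule integral_complex_of_real[symmetric])
  also have "\<dots> = (\<integral>x. (\<Sum>p\<in>?Perm. \<Sum>q\<in>?Perm. of_int (sign p * sign q) * T p q x) \<partial>?L)"
    by (rule Bochner_Integration.integral_cong[OF refl])
       (simp add: ginibre_weight_expansion T_def \<Phi>_def planar_monomial_def sum_distrib_left mult_ac)
  also have "\<dots> = (\<Sum>p\<in>?Perm. \<Sum>q\<in>?Perm. of_int (sign p * sign q) * integral\<^sup>L ?L (T p q))"
    using T_int by (simp add: Bochner_Integration.integral_sum)
  also have "\<dots> = (\<Sum>p\<in>?Perm. of_real (?Z * ?I))"
  proof (rule sum.cong[OF refl])
    fix p assume p: "p \<in> ?Perm"
    have "(\<Sum>q\<in>?Perm. of_int (sign p * sign q) * integral\<^sup>L ?L (T p q)) = (\<Sum>q\<in>{p}. of_int (sign p * sign q) * integral\<^sup>L ?L (T p q))"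
      by (rule sum.mono_neutral_right) (use p T_off[OF not_sym] in \<open>auto simp: finite_permutations\<close>)
    also have "\<dots> = of_real (?Z * ?I)"
      using p T_diag by (simp add: sign_def)
    finally show "(\<Sum>q\<in>?Perm. of_int (sign p * sign q) * integral\<^sup>L ?L (T p q)) = of_real (?Z * ?I)" .
  qed
  also have "\<dots> = of_real (real (fact CARD('n)) * ?Z * ?I)"
    by (simp add: card_permutations[OF refl])
  finally show ?thesis by (simp only: of_real_eq_iff)
qed

lemma integral_ginibre_weight_pos:
  "0 < (\<integral>z. ginibre_weight (z :: 'n::{finite,linorder} cspace) \<partial>lborel)"
proof -
  have "(\<integral>z. ginibre_weight (z :: 'n cspace) \<partial>lborel) = real (fact CARD('n)) * (\<Prod>i\<in>(UNIV :: 'n set). 2 * pi * radial_mass (real CARD('n)) (rank_of i)) *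
    (\<integral>r. 1 \<partial>PiM UNIV (\<lambda>i::'n. radial_law (real CARD('n)) (rank_of i)))"
    using integral_ginibre_weight_radial[of "\<lambda>_. 1" 1] by (simp add: symmetric_def)
  also have "(\<integral>r. 1 \<partial>PiM UNIV (\<lambda>i::'n. radial_law (real CARD('n)) (rank_of i))) = (1::real)"
  proof -
    interpret prob_space "PiM UNIV (\<lambda>i::'n. radial_law (real CARD('n)) (rank_of i))"
      by (rule prob_space_PiM) (rule prob_space_radial_law, simp)
    show ?thesis using prob_space by simp
  qed
  finally show ?thesis using radial_mass_pos by (auto intro!: prod_pos mult_pos_pos)
qed

lemma ginibre_weight_nonneg: "0 \<le> ginibre_weight z"
  unfolding ginibre_weight_def by (auto intro!: mult_nonneg_nonneg prod_nonneg)

lemma integrable_ginibre_weight: "integrable lborel (ginibre_weight :: 'n::{finite,linorder} cspace \<Rightarrow> real)"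
  using integral_ginibre_weight_pos[where 'n='n] not_integrable_integral_eq[of lborel "ginibre_weight :: 'n cspace \<Rightarrow> real"] by fastforce

lemma sets_ginibre[measurable_cong, simp]: "sets ginibre = sets borel"
  and space_ginibre[simp]: "space ginibre = UNIV"
  by (simp_all add: ginibre_def)

lemma prob_space_ginibre: "prob_space (ginibre :: ('n::{finite,linorder} cspace) measure)"
proof (rule prob_spaceI)
  let ?c = "\<integral>w. ginibre_weight (w :: 'n cspace) \<partial>lborel"
  have "emeasure ginibre (space (ginibre :: ('n cspace) measure)) = (\<integral>\<^sup>+z. ennreal (ginibre_weight (z :: 'n cspace) / ?c) \<partial>lborel)"
    by (simp add: ginibre_def emeasure_density)
  also have "\<dots> = ennreal (\<integral>z. ginibre_weight (z :: 'n cspace) / ?c \<partial>lborel)"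
  proof (rule nn_integral_eq_integral)
    show "integrable lborel (\<lambda>z. ginibre_weight (z :: 'n cspace) / ?c)"
      by (rule Bochner_Integration.integrable_divide_zero) (rule integrable_ginibre_weight)
  qed (intro AE_I2 divide_nonneg_pos ginibre_weight_nonneg integral_ginibre_weight_pos)
  also have "\<dots> = 1" using integral_ginibre_weight_pos[where 'n='n] by simp
  finally show "emeasure ginibre (space (ginibre :: ('n cspace) measure)) = 1" .
qed

text \<open>
  The case $F = 1$ of \<open>integral_ginibre_weight_radial\<close> computes the normalising constant, which cancels.
\<close>

theorem integral_ginibre_radial:
  fixes F :: "(real, 'n::{finite,linorder}) vec \<Rightarrow> real"
  assumes F: "F \<in> borel_measurable borel" and sym: "symmetric F" and bound: "\<And>r. \<bar>F r\<bar> \<le> B"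
  shows "(\<integral>z. radial F z \<partial>ginibre) =
    (\<integral>r. F (vec_lambda r) \<partial>PiM UNIV (\<lambda>i. radial_law (real CARD('n)) (rank_of i)))"
proof -
  let ?c = "\<integral>w. ginibre_weight (w :: 'n cspace) \<partial>lborel"
  let ?R = "PiM UNIV (\<lambda>i::'n. radial_law (real CARD('n)) (rank_of i))"
  define K where "K = real (fact CARD('n)) * (\<Prod>i\<in>(UNIV :: 'n set). 2 * pi * radial_mass (real CARD('n)) (rank_of i))"
  interpret R: prob_space ?R
    by (rule prob_space_PiM) (rule prob_space_radial_law, simp)
  have c: "?c = K" using integral_ginibre_weight_radial[of "\<lambda>_ :: (real, 'n) vec. 1" 1] R.prob_space
    by (simp add: symmetric_def K_def)
  have Fm: "(\<lambda>z :: 'n cspace. F (\<chi> i. cmod (z $ i))) \<in> borel_measurable borel"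
  proof -
    have "(\<lambda>z. \<chi> i. cmod (z $ i)) \<in> borel_measurable (borel :: ((complex, 'n) vec) measure)"
      by (intro borel_measurable_continuous_onI continuous_intros)
    from measurable_compose[OF this F] show ?thesis .
  qed
  have "(\<integral>z. radial F z \<partial>ginibre) = (\<integral>z. ginibre_weight z / ?c * F (\<chi> i. cmod (z $ i)) \<partial>lborel)"
    unfolding ginibre_def radial_def
    by (rule integral_real_density)
       (simp_all add: Fm AE_I2[OF divide_nonneg_pos[OF ginibre_weight_nonneg integral_ginibre_weight_pos]])
  also have "\<dots> = (\<integral>z. F (\<chi> i. cmod (z $ i)) * ginibre_weight z \<partial>lborel) / ?c"
    by (subst integral_divide_zero[symmetric]) (simp add: mult.commute)
  also have "\<dots> = (K * (\<integral>r. F (vec_lambda r) \<partial>?R)) / K"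
    unfolding c integral_ginibre_weight_radial[OF F sym bound] K_def ..
  also have "\<dots> = (\<integral>r. F (vec_lambda r) \<partial>?R)"
    using integral_ginibre_weight_pos[where 'n='n] unfolding c by simp
  finally show ?thesis .
qed

section \<open>Calculus of radial functions\<close>

text \<open>
  Continuity at 0 is the limit $t \ln t \to 0$, which matches the convention $0 \log 0 = 0$.
\<close>

lemma continuous_on_mult_ln: "continuous_on {0..} (\<lambda>t::real. t * ln t)"
proof (rule continuous_on_eq_continuous_within[THEN iffD2], rule ballI)
  fix x :: real assume "x \<in> {0..}"
  show "continuous (at x within {0..}) (\<lambda>t. t * ln t)"
  proof (cases "x = 0")
    case True
    have "((\<lambda>t::real. t * ln t) \<longlongrightarrow> 0) (at_right 0)" by real_asymp
    then have "((\<lambda>t::real. t * ln t) \<longlongrightarrow> 0) (at 0 within {0..})"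
      by (simp add: at_within_Ici_at_right)
    then show ?thesis by (simp add: continuous_within True)
  next
    case False
    then have "isCont (\<lambda>t. t * ln t) x" by (intro continuous_intros) auto
    then show ?thesis by (rule continuous_at_imp_continuous_at_within)
  qed
qed

lemma tendsto_mult_ln:
  assumes "(f \<longlongrightarrow> l) F" "eventually (\<lambda>x. 0 \<le> f x) F" "0 \<le> l"
  shows "((\<lambda>x. f x * ln (f x)) \<longlongrightarrow> l * ln (l :: real)) F"
  by (rule continuous_on_tendsto_compose[OF continuous_on_mult_ln assms(1)]) (use assms in auto)

lemma mult_ln_ge: "- 1 \<le> t * ln (t :: real)" if "0 \<le> t"
proof (cases "t = 0")
  case False
  then have "ln (1 / t) \<le> 1 / t - 1" using that by (intro ln_le_minus_one) auto
  then have "t * ln (1 / t) \<le> t * (1 / t - 1)" using that by (intro mult_left_mono) auto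
  then show ?thesis using that False by (simp add: ln_div algebra_simps)
qed simp

lemma mult_ln_le: "t * ln (t :: real) \<le> t\<^sup>2" if "0 \<le> t"
proof (cases "t = 0")
  case False
  then have "t * ln t \<le> t * t" using that ln_bound[of t] by (intro mult_left_mono) auto
  then show ?thesis by (simp add: power2_eq_square)
qed simp

text \<open>
  Since the support of \<open>F\<close> is a compact subset of the open orthant, \<open>F\<close> extended by zero is of class
  $C^1$ on the whole space, and its partial derivatives are globally defined and bounded.
\<close>

locale positive_test_function =
  fixes F :: "real ^ 'n::finite \<Rightarrow> real"
  assumes test_function: "F \<in> Cc_infty {x. \<forall>i. 0 < x $ i}"
begin

definition partial :: "'n \<Rightarrow> real ^ 'n \<Rightarrow> real" where
  "partial i x = frechet_derivative F (at x) (axis i 1)"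

definition supp where "supp = closure {x. F x \<noteq> 0}"

lemma compact_supp: "compact supp" and supp_positive: "supp \<subseteq> {x. \<forall>i. 0 < x $ i}"
  using test_function by (auto simp: Cc_infty_def supp_def)

lemma F_zero: "x \<notin> supp \<Longrightarrow> F x = 0"
  using closure_subset[of "{x. F x \<noteq> 0}"] by (auto simp: supp_def)

lemma open_compl_supp: "open (- supp)" by (simp add: supp_def open_Compl)

lemma open_positive: "open {x :: real ^ 'n. \<forall>i. 0 < x $ i}"
proof -
  have "{x :: real ^ 'n. \<forall>i. 0 < x $ i} = (\<Inter>i. {x. 0 < x $ i})" by auto
  then show ?thesis by (simp only:) (intro open_INT finite ballI open_Collect_less continuous_intros)
qed

lemma has_derivative_zero: "(F has_derivative (\<lambda>_. 0)) (at x)" if "x \<notin> supp"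
proof (rule has_derivative_transform_within_open[of "\<lambda>_. 0"])
  show "open (- supp)" "x \<in> - supp" using open_compl_supp that by auto
qed (auto simp: F_zero)

lemma differentiable_F: "F differentiable (at x)"
proof (cases "x \<in> supp")
  case True
  then have "x \<in> {x. \<forall>i. 0 < x $ i}" using supp_positive by auto
  moreover have "Ck_on 1 {x. \<forall>i. 0 < x $ i} F" using test_function by (simp add: Cc_infty_def smooth_on_def)
  ultimately show ?thesis by (simp add: One_nat_def)
next
  case False
  then show ?thesis using has_derivative_zero differentiable_def by blast
qed

lemma has_derivative_F: "(F has_derivative frechet_derivative F (at x)) (at x)"
  using differentiable_F by (simp add: frechet_derivative_works)

lemma frechet_derivative_F: "frechet_derivative F (at x) v = (\<Sum>i\<in>UNIV. v $ i * partial i x)"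
proof -
  interpret bounded_linear "frechet_derivative F (at x)"
    using has_derivative_F by (rule has_derivative_bounded_linear)
  have "v = (\<Sum>i\<in>UNIV. v $ i *\<^sub>R axis i 1)" by (simp add: vec_eq_iff axis_def if_distrib cong: if_cong)
  then have "frechet_derivative F (at x) v = frechet_derivative F (at x) (\<Sum>i\<in>UNIV. v $ i *\<^sub>R axis i 1)" by simp
  then show ?thesis by (simp add: sum scaleR partial_def)
qed

lemma partial_zero: "x \<notin> supp \<Longrightarrow> partial i x = 0"
  using has_derivative_zero[of x] frechet_derivative_at[of F "\<lambda>_. 0" x] by (simp add: partial_def fun_eq_iff)

lemma continuous_F: "continuous_on UNIV F"
  by (intro continuous_at_imp_continuous_on ballI differentiable_imp_continuous_within differentiable_F)

lemma continuous_partial: "continuous_on UNIV (partial i)"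
proof -
  have "Ck_on 1 {x. \<forall>i. 0 < x $ i} F" using test_function by (simp add: Cc_infty_def smooth_on_def)
  then have "continuous_on {x. \<forall>i. 0 < x $ i} (partial i)"
    by (simp add: One_nat_def partial_def[abs_def])
  moreover have "continuous_on (- supp) (partial i)"
    by (rule continuous_on_eq[of _ "\<lambda>_. 0"]) (auto simp: partial_zero)
  ultimately have "continuous_on ({x. \<forall>i. 0 < x $ i} \<union> - supp) (partial i)"
    by (intro continuous_on_open_Un open_positive open_compl_supp)
  moreover have "{x. \<forall>i. 0 < x $ i} \<union> - supp = UNIV" using supp_positive by auto
  ultimately show ?thesis by simp
qed

lemma bounded_of_support:
  fixes h :: "real ^ 'n \<Rightarrow> real"
  assumes "continuous_on UNIV h" "\<And>x. x \<notin> supp \<Longrightarrow> h x = 0"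
  shows "\<exists>B\<ge>0. \<forall>x. \<bar>h x\<bar> \<le> B"
proof -
  have "compact (h ` supp)"
    by (rule compact_continuous_image[OF continuous_on_subset[OF assms(1)] compact_supp]) simp
  then have "bounded (h ` supp)" by (rule compact_imp_bounded)
  then obtain B where B: "\<And>x. x \<in> supp \<Longrightarrow> \<bar>h x\<bar> \<le> B" unfolding bounded_iff by auto
  have "\<bar>h x\<bar> \<le> max B 0" for x
    using B[of x] assms(2)[of x] by (cases "x \<in> supp") auto
  then show ?thesis by (intro exI[of _ "max B 0"]) auto
qed

lemma bounded_F_partial: "\<exists>B\<ge>0. (\<forall>x. \<bar>F x\<bar> \<le> B) \<and> (\<forall>i x. \<bar>partial i x\<bar> \<le> B)"
proof -
  obtain B0 where B0: "0 \<le> B0" "\<And>x. \<bar>F x\<bar> \<le> B0"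
    using bounded_of_support[OF continuous_F F_zero] by auto
  obtain B where B: "\<And>i. 0 \<le> B i" "\<And>i x. \<bar>partial i x\<bar> \<le> B i"
    using bounded_of_support[OF continuous_partial partial_zero] by metis
  have "B i \<le> sum B UNIV" for i by (rule member_le_sum) (auto simp: B)
  then have "\<bar>partial i x\<bar> \<le> B0 + sum B UNIV" for i x using B(2)[of i x] B0(1) by (smt (verit))
  moreover have "\<bar>F x\<bar> \<le> B0 + sum B UNIV" for x
    using B0(2)[of x] sum_nonneg[of UNIV B] B(1) by (smt (verit))
  ultimately show ?thesis using B0(1) sum_nonneg[of UNIV B] B(1) by (intro exI[of _ "B0 + sum B UNIV"]) auto
qed

definition sq_grad :: "real ^ 'n \<Rightarrow> real" where
  "sq_grad x = (\<Sum>i\<in>UNIV. (partial i x)\<^sup>2)"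

text \<open>
  A permutation of the coordinates is a linear map that leaves \<open>F\<close> invariant, so it permutes the partial
  derivatives of \<open>F\<close>.
\<close>

lemma symmetric_sq_grad:
  assumes sym: "symmetric F"
  shows "symmetric sq_grad"
  unfolding symmetric_def
proof (intro allI impI)
  fix p :: "'n \<Rightarrow> 'n" and x :: "real ^ 'n"
  assume p: "bij p"
  define P where "P = (\<lambda>x :: real ^ 'n. \<chi> i. x $ p i)"
  have lin: "bounded_linear P"
    unfolding P_def by (intro linear_conv_bounded_linear[THEN iffD1] linearI) (auto simp: vec_eq_iff)
  have FP: "F \<circ> P = F" using sym p by (auto simp: symmetric_def P_def fun_eq_iff)
  have "(F \<circ> P has_derivative frechet_derivative F (at (P x)) \<circ> P) (at x)"
    by (rule diff_chain_at[OF bounded_linear_imp_has_derivative[OF lin] has_derivative_F])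
  then have eq: "frechet_derivative F (at x) = frechet_derivative F (at (P x)) \<circ> P"
    unfolding FP by (metis frechet_derivative_at)
  have "partial (p i) x = partial i (P x)" for i
  proof -
    have "P (axis (p i) 1) = axis i 1"
      using p by (auto simp: P_def vec_eq_iff axis_def bij_def inj_eq)
    then show ?thesis by (simp add: partial_def eq)
  qed
  then have "sq_grad (P x) = (\<Sum>i\<in>UNIV. (partial (p i) x)\<^sup>2)" by (simp add: sq_grad_def)
  also have "\<dots> = sq_grad x"
    unfolding sq_grad_def by (rule sum.reindex_bij_betw[of p UNIV UNIV "\<lambda>i. (partial i x)\<^sup>2"]) (use p in simp)
  finally show "sq_grad (\<chi> i. x $ p i) = sq_grad x" by (simp add: P_def)
qed

text \<open>
  Away from the coordinate hyperplanes this is the chain rule with $\nabla |w| = w / |w|$. On them the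
  modulus is not differentiable, but there \<open>F\<close> vanishes in a neighbourhood of the moduli.
\<close>

lemma GDERIV_radial:
  fixes z :: "complex ^ 'n"
  shows "GDERIV (radial F) z :> (\<chi> i. partial i (\<chi> i. cmod (z $ i)) *\<^sub>R sgn (z $ i))"
proof (cases "\<forall>i. z $ i \<noteq> 0")
  case True
  let ?r = "\<lambda>z :: complex ^ 'n. \<chi> i. cmod (z $ i)"
  have "(?r has_derivative (\<lambda>h. \<chi> i. h $ i \<bullet> sgn (z $ i))) (at z)"
  proof (subst has_derivative_componentwise_within, rule ballI)
    fix b :: "real ^ 'n" assume "b \<in> Basis"
    then obtain i where b: "b = axis i 1" by (auto simp: Basis_vec_def)
    have "(norm has_derivative (\<lambda>h. h \<bullet> sgn (z $ i))) (at (z $ i))"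
      using True GDERIV_norm[of "z $ i"] by (simp add: gderiv_def)
    moreover have "((\<lambda>z :: complex ^ 'n. z $ i) has_derivative (\<lambda>h. h $ i)) (at z)"
      by (rule bounded_linear_imp_has_derivative) (rule bounded_linear_vec_nth)
    ultimately have "((\<lambda>z. cmod (z $ i)) has_derivative (\<lambda>h. h $ i \<bullet> sgn (z $ i))) (at z)"
      using diff_chain_at[of "\<lambda>z. z $ i" "\<lambda>h. h $ i" z norm] by (simp add: o_def)
    then show "((\<lambda>z. ?r z \<bullet> b) has_derivative (\<lambda>h. (\<chi> i. h $ i \<bullet> sgn (z $ i)) \<bullet> b)) (at z)"
      by (simp add: b inner_axis)
  qed
  from diff_chain_at[OF this has_derivative_F]
  have "(radial F has_derivative (\<lambda>h. frechet_derivative F (at (?r z)) (\<chi> i. h $ i \<bullet> sgn (z $ i)))) (at z)"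
    unfolding o_def radial_def[abs_def] .
  moreover have "frechet_derivative F (at (?r z)) (\<chi> i. h $ i \<bullet> sgn (z $ i)) =
      h \<bullet> (\<chi> i. partial i (?r z) *\<^sub>R sgn (z $ i))" for h :: "complex ^ 'n"
    unfolding frechet_derivative_F inner_vec_def vec_lambda_beta inner_scaleR_right
    by (rule sum.cong[OF refl]) (rule mult.commute)
  ultimately show ?thesis unfolding gderiv_def by (simp only:)
next
  case False
  let ?r = "\<lambda>z :: complex ^ 'n. \<chi> i. cmod (z $ i)"
  have z: "?r z \<notin> supp" using False supp_positive by force
  have op: "open (?r -` (- supp))"
    by (rule open_vimage[OF open_compl_supp]) (intro continuous_intros)
  have "(radial F has_derivative (\<lambda>_. 0)) (at z)"
  proof (rule has_derivative_transform_within_open[OF _ op])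
    show "((\<lambda>_. 0) has_derivative (\<lambda>_. 0)) (at z)" by simp
  qed (use z in \<open>auto simp: radial_def F_zero\<close>)
  moreover have "(\<chi> i. partial i (?r z) *\<^sub>R sgn (z $ i)) = 0"
    using partial_zero[OF z] by (simp add: vec_eq_iff)
  ultimately show ?thesis unfolding gderiv_def by (simp only: inner_zero_right)
qed

lemma gradient_radial:
  "gradient (radial F) z = (\<chi> i. partial i (\<chi> i. cmod (z $ i)) *\<^sub>R sgn (z $ i))"
  unfolding gradient_def
proof (rule the_equality)
  let ?G = "\<chi> i. partial i (\<chi> i. cmod (z $ i)) *\<^sub>R sgn (z $ i)"
  fix D assume "GDERIV (radial F) z :> D"
  then have "(\<lambda>h. h \<bullet> D) = (\<lambda>h. h \<bullet> ?G)"
    using GDERIV_radial[of z] unfolding gderiv_def by (rule has_derivative_unique)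
  then have "\<forall>h. h \<bullet> D = h \<bullet> ?G" by (rule fun_cong[THEN allI])
  then show "D = ?G" by (rule vector_eq_ldot[THEN iffD1])
qed (rule GDERIV_radial)

lemma norm_gradient_radial: "(norm (gradient (radial F) z))\<^sup>2 = radial sq_grad z"
proof -
  let ?r = "\<chi> i. cmod (z $ i)"
  have "(norm (gradient (radial F) z))\<^sup>2 = (\<Sum>i\<in>UNIV. (partial i ?r)\<^sup>2 * (norm (sgn (z $ i)))\<^sup>2)"
    unfolding gradient_radial norm_vec_def L2_set_def
    by (simp add: sum_nonneg power_mult_distrib)
  also have "\<dots> = (\<Sum>i\<in>UNIV. (partial i ?r)\<^sup>2)"
  proof (rule sum.cong[OF refl])
    fix i
    show "(partial i ?r)\<^sup>2 * (norm (sgn (z $ i)))\<^sup>2 = (partial i ?r)\<^sup>2"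
    proof (cases "z $ i = 0")
      case True
      then have "?r \<notin> supp" using supp_positive by force
      then show ?thesis by (simp add: partial_zero)
    qed (simp add: norm_sgn)
  qed
  finally show ?thesis by (simp add: radial_def sq_grad_def)
qed

lemma continuous_sq_grad: "continuous_on UNIV sq_grad"
  unfolding sq_grad_def[abs_def] by (intro continuous_intros continuous_partial)

lemma measurable_gradient_radial: "gradient (radial F) \<in> borel_measurable borel"
proof -
  have r: "(\<lambda>z :: complex ^ 'n. \<chi> i. cmod (z $ i)) \<in> borel_measurable borel"
    by (intro borel_measurable_continuous_onI continuous_intros)
  have p: "(\<lambda>z :: complex ^ 'n. partial i (\<chi> i. cmod (z $ i))) \<in> borel_measurable borel" for i
    using measurable_compose[OF r borel_measurable_continuous_onI[OF continuous_partial]] .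
  have s: "(\<lambda>z :: complex ^ 'n. sgn (z $ i)) \<in> borel_measurable borel" for i
  proof -
    have c: "(\<lambda>z :: complex ^ 'n. z $ i) \<in> borel_measurable borel"
      by (intro borel_measurable_continuous_onI continuous_intros)
    show ?thesis
      unfolding sgn_div_norm
      by (rule borel_measurable_scaleR[OF borel_measurable_inverse[OF measurable_compose[OF c borel_measurable_norm]] c])
  qed
  show ?thesis
  proof (rule borel_measurable_euclidean_space[THEN iffD2], rule ballI)
    fix b :: "complex ^ 'n" assume "b \<in> Basis"
    then obtain i u where "b = axis i u" by (auto simp: Basis_vec_def)
    then have b: "gradient (radial F) z \<bullet> b
        = (partial i (\<chi> i. cmod (z $ i)) *\<^sub>R sgn (z $ i)) \<bullet> u" for z :: "complex ^ 'n"
      by (simp only: gradient_radial inner_axis vec_lambda_beta)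
    show "(\<lambda>z. gradient (radial F) z \<bullet> b) \<in> borel_measurable borel"
      unfolding b by (rule borel_measurable_inner[OF borel_measurable_scaleR[OF p s] borel_measurable_const])
  qed
qed

end

section \<open>The inequality for smooth symmetric radial functions\<close>

lemma abs_mult_ln_bound: "\<bar>t * ln (t :: real)\<bar> \<le> 1 + B\<^sup>2" if "0 \<le> t" "t \<le> B"
proof -
  have "t\<^sup>2 \<le> B\<^sup>2" using that by (intro power_mono) auto
  moreover have "0 \<le> B\<^sup>2" by simp
  ultimately show ?thesis using mult_ln_ge[OF that(1)] mult_ln_le[OF that(1)] by linarith
qed

context positive_test_function
begin

lemma measurable_F: "F \<in> borel_measurable borel"
  and measurable_partial: "partial i \<in> borel_measurable borel"
  and measurable_sq_grad: "sq_grad \<in> borel_measurable borel"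
  using borel_measurable_continuous_onI[OF continuous_F] borel_measurable_continuous_onI[OF continuous_partial]
    borel_measurable_continuous_onI[OF continuous_sq_grad] by blast+

lemma has_derivative_slice:
  "((\<lambda>t. F (vec_lambda (r(i := t)))) has_real_derivative partial i (vec_lambda (r(i := t)))) (at t)"
proof -
  let ?g = "\<lambda>t. vec_lambda (r(i := t)) :: real ^ 'n"
  have g: "?g = (\<lambda>t. vec_lambda (r(i := 0)) + t *\<^sub>R axis i 1)"
    by (auto simp: fun_eq_iff vec_eq_iff axis_def)
  have "(?g has_derivative (\<lambda>s. s *\<^sub>R axis i 1)) (at t)"
    unfolding g by (auto intro!: derivative_eq_intros)
  from diff_chain_at[OF this has_derivative_F]
  have "((\<lambda>t. F (?g t)) has_derivative (\<lambda>s. frechet_derivative F (at (?g t)) (s *\<^sub>R axis i 1))) (at t)"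
    unfolding o_def .
  moreover have "frechet_derivative F (at (?g t)) (s *\<^sub>R axis i 1) = partial i (?g t) * s" for s
    using linear_scale[OF has_derivative_linear[OF has_derivative_F], of "?g t" s "axis i 1"]
    by (simp add: partial_def mult.commute)
  ultimately show ?thesis unfolding has_field_derivative_def by (simp only:)
qed

context
  fixes N :: real and a :: "'n \<Rightarrow> nat"
  assumes N: "0 < N"
begin

abbreviation "\<nu> i \<equiv> radial_law N (a i)"
abbreviation "\<pi> \<equiv> PiM UNIV (\<lambda>i. radial_law N (a i))"

lemma prob_nu: "prob_space (\<nu> i)" by (rule prob_space_radial_law[OF N])

interpretation P: prob_space \<pi>
  by (rule prob_space_PiM) (rule prob_nu)

lemma measurable_vec_pi:
  assumes "h \<in> borel_measurable borel"
  shows "(\<lambda>r. h (vec_lambda r :: real ^ 'n)) \<in> borel_measurable \<pi>"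
  using measurable_compose[OF measurable_vec_lambda assms] by (simp cong: measurable_cong_sets sets_PiM_cong)

lemma Ent_slice_le:
  assumes "0 < \<epsilon>"
  shows "Ent (\<nu> i) (\<lambda>t. (F (vec_lambda (r(i := t))))\<^sup>2 + \<epsilon>)
    \<le> 1 / N * (\<integral>t. (partial i (vec_lambda (r(i := t))))\<^sup>2 \<partial>\<nu> i)"
proof -
  obtain B where B: "\<And>x. \<bar>F x\<bar> \<le> B" "\<And>i x. \<bar>partial i x\<bar> \<le> B" using bounded_F_partial by auto
  have g: "continuous_on UNIV (\<lambda>t. vec_lambda (r(i := t)) :: real ^ 'n)"
  proof (rule continuous_on_vec_lambda)
    show "continuous_on UNIV (\<lambda>t. (r(i := t)) j)" for j
      by (cases "j = i") (auto intro: continuous_intros)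
  qed
  have c1: "continuous_on UNIV (\<lambda>t. F (vec_lambda (r(i := t))))"
    by (rule continuous_on_compose2[OF continuous_F g]) simp
  have c2: "continuous_on UNIV (\<lambda>t. partial i (vec_lambda (r(i := t))))"
    by (rule continuous_on_compose2[OF continuous_partial g]) simp
  show ?thesis
    by (rule lsi_radial_law[OF N assms borel_measurable_continuous_onI[OF c1] borel_measurable_continuous_onI[OF c2]
          has_derivative_slice continuous_on_subset[OF c2] B]) simp
qed

text \<open>
  The slices of \<open>F\<close> satisfy the one-dimensional inequality with the same constant for all coordinates;
  averaging over the coordinate in question leaves integrals over the product unchanged.
\<close>

lemma lsi_product_eps:
  assumes \<epsilon>: "0 < \<epsilon>"
  shows "Ent \<pi> (\<lambda>r. (F (vec_lambda r))\<^sup>2 + \<epsilon>) \<le> 1 / N * (\<integral>r. sq_grad (vec_lambda r) \<partial>\<pi>)"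
proof -
  obtain B where B: "\<And>x. \<bar>F x\<bar> \<le> B" "\<And>i x. \<bar>partial i x\<bar> \<le> B" using bounded_F_partial by auto
  have sq: "(F x)\<^sup>2 \<le> B\<^sup>2" "(partial i x)\<^sup>2 \<le> B\<^sup>2" for i x
    using B(1)[of x] B(2)[of i x] by (auto intro: abs_le_square_iff[THEN iffD1])
  let ?h = "\<lambda>r. (F (vec_lambda r))\<^sup>2 + \<epsilon>"
  let ?D = "\<lambda>i r. (partial i (vec_lambda r))\<^sup>2"
  have sp: "\<And>i. space (\<nu> i) = UNIV" by simp
  have h[measurable]: "?h \<in> borel_measurable \<pi>"
    by (intro borel_measurable_add borel_measurable_power measurable_vec_pi measurable_F borel_measurable_const)
  have D[measurable]: "?D i \<in> borel_measurable \<pi>" for i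
    by (intro borel_measurable_power measurable_vec_pi measurable_partial)
  have Db: "\<bar>?D i r\<bar> \<le> B\<^sup>2" for i r using sq(2) by simp
  have D_int: "integrable \<pi> (?D i)" for i
    by (rule P.integrable_const_bound[of _ "B\<^sup>2"]) (use Db D in auto)
  have avg_int: "integrable \<pi> (avg \<nu> i (?D i))" for i
  proof (rule P.integrable_const_bound[of _ "B\<^sup>2"])
    show "avg \<nu> i (?D i) \<in> borel_measurable \<pi>" by (rule measurable_avg[OF prob_nu sp D])
    show "AE r in \<pi>. norm (avg \<nu> i (?D i) r) \<le> B\<^sup>2"
      unfolding real_norm_def abs_le_iff
      using avg_bounds[OF prob_nu sp D, where a="- B\<^sup>2" and B="B\<^sup>2"] Db
      by (simp add: abs_le_iff minus_le_iff)
  qed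
  have "Ent \<pi> ?h \<le> (\<Sum>i\<in>UNIV. \<integral>r. Ent (\<nu> i) (\<lambda>t. ?h (r(i := t))) \<partial>\<pi>)"
    by (rule Ent_PiM_le[OF prob_nu sp h \<epsilon>, of "B\<^sup>2 + \<epsilon>"]) (use sq in auto)
  also have "\<dots> \<le> (\<Sum>i\<in>UNIV. \<integral>r. 1 / N * avg \<nu> i (?D i) r \<partial>\<pi>)"
  proof (intro sum_mono integral_mono')
    show "integrable \<pi> (\<lambda>r. 1 / N * avg \<nu> i (?D i) r)" for i using avg_int[of i] by simp
    show "Ent (\<nu> i) (\<lambda>t. ?h (r(i := t))) \<le> 1 / N * avg \<nu> i (?D i) r" for i r
      unfolding avg_def[OF prob_nu sp] by (rule Ent_slice_le[OF \<epsilon>])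
    show "0 \<le> 1 / N * avg \<nu> i (?D i) r" for i r
      using N unfolding avg_def[OF prob_nu sp] by (intro mult_nonneg_nonneg integral_nonneg) auto
  qed
  also have "\<dots> = (\<Sum>i\<in>UNIV. 1 / N * (\<integral>r. ?D i r \<partial>\<pi>))"
    using integral_avg[OF prob_nu sp D Db] by simp
  also have "\<dots> = 1 / N * (\<integral>r. sq_grad (vec_lambda r) \<partial>\<pi>)"
    unfolding sq_grad_def using D_int by (simp add: Bochner_Integration.integral_sum sum_distrib_left)
  finally show ?thesis .
qed

lemma lsi_product:
  "Ent \<pi> (\<lambda>r. (F (vec_lambda r))\<^sup>2) \<le> 1 / N * (\<integral>r. sq_grad (vec_lambda r) \<partial>\<pi>)"
proof -
  obtain B where B: "\<And>x. \<bar>F x\<bar> \<le> B" using bounded_F_partial by auto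
  have sq: "(F x)\<^sup>2 \<le> B\<^sup>2" for x
    using B(1)[of x] by (auto intro: abs_le_square_iff[THEN iffD1])
  let ?f = "\<lambda>r. (F (vec_lambda r))\<^sup>2"
  have f[measurable]: "?f \<in> borel_measurable \<pi>"
    by (intro borel_measurable_power measurable_vec_pi measurable_F)
  \<comment> \<open>The positive shift \<open>\<epsilon>\<close> is removed by dominated convergence; \<open>t ln t\<close> is continuous up to 0.\<close>
  let ?e = "\<lambda>k. 1 / real (Suc k)"
  have e: "?e \<longlonglongrightarrow> 0" "0 < ?e k" "?e k \<le> 1" for k
    using LIMSEQ_Suc[OF lim_1_over_n] by auto
  have lim: "(\<lambda>k. ?f r + ?e k) \<longlonglongrightarrow> ?f r" for r
    using tendsto_add[OF tendsto_const e(1), of "?f r"] by simp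
  have l1: "(\<lambda>k. \<integral>r. ?f r + ?e k \<partial>\<pi>) \<longlonglongrightarrow> (\<integral>r. ?f r \<partial>\<pi>)"
  proof (rule integral_dominated_convergence[where w="\<lambda>_. B\<^sup>2 + 1"])
    show "AE r in \<pi>. norm (?f r + ?e k) \<le> B\<^sup>2 + 1" for k
    proof (rule AE_I2)
      fix r
      show "norm (?f r + ?e k) \<le> B\<^sup>2 + 1" using sq[of "vec_lambda r"] e(2,3)[of k] by (simp add: add_mono)
    qed
  qed (use lim in auto)
  have l2: "(\<lambda>k. \<integral>r. (?f r + ?e k) * ln (?f r + ?e k) \<partial>\<pi>) \<longlonglongrightarrow> (\<integral>r. ?f r * ln (?f r) \<partial>\<pi>)"
  proof (rule integral_dominated_convergence[where w="\<lambda>_. 1 + (B\<^sup>2 + 1)\<^sup>2"])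
    show "AE r in \<pi>. (\<lambda>k. (?f r + ?e k) * ln (?f r + ?e k)) \<longlonglongrightarrow> ?f r * ln (?f r)"
      by (intro AE_I2 tendsto_mult_ln lim) auto
    show "AE r in \<pi>. norm ((?f r + ?e k) * ln (?f r + ?e k)) \<le> 1 + (B\<^sup>2 + 1)\<^sup>2" for k
    proof (rule AE_I2)
      fix r
      show "norm ((?f r + ?e k) * ln (?f r + ?e k)) \<le> 1 + (B\<^sup>2 + 1)\<^sup>2"
        unfolding real_norm_def using sq[of "vec_lambda r"] e(2,3)[of k]
        by (intro abs_mult_ln_bound add_mono add_nonneg_nonneg) (auto simp: less_imp_le)
    qed
  qed auto
  have "(\<lambda>k. Ent \<pi> (\<lambda>r. ?f r + ?e k)) \<longlonglongrightarrow> Ent \<pi> ?f"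
    unfolding Ent_def
    by (intro tendsto_diff l2 tendsto_mult_ln[OF l1] eventuallyI integral_nonneg) (auto simp: add_nonneg_nonneg)
  then show ?thesis
    by (rule LIMSEQ_le_const2) (intro exI allI impI lsi_product_eps e(2))
qed

end
end

text \<open>
  The entropy and the energy involve three integrands, $f^2 \ln f^2$, $f^2$ and $|\nabla f|^2$. Each is a
  bounded symmetric function of the moduli, so all three integrals may be taken over the product
  measure.
\<close>

lemma Ent_ginibre_radial_le:
  fixes F :: "(real, 'n::{finite,linorder}) vec \<Rightarrow> real"
  assumes "positive_test_function F" and sym: "symmetric F"
  shows "Ent ginibre (\<lambda>z. (radial F z)\<^sup>2) \<le> energy (gradient (radial F))"
proof -
  interpret positive_test_function F by fact
  let ?N = "real CARD('n)"
  let ?\<pi> = "PiM UNIV (\<lambda>i::'n. radial_law ?N (rank_of i))"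
  obtain B where B: "\<And>x. \<bar>F x\<bar> \<le> B" using bounded_F_partial by auto
  have sq: "(F x)\<^sup>2 \<le> B\<^sup>2" for x
    using B(1)[of x] by (auto intro: abs_le_square_iff[THEN iffD1])
  note [measurable] = measurable_F
  have i1: "(\<integral>z. (radial F z)\<^sup>2 * ln ((radial F z)\<^sup>2) \<partial>ginibre) = (\<integral>r. (F (vec_lambda r))\<^sup>2 * ln ((F (vec_lambda r))\<^sup>2) \<partial>?\<pi>)"
  proof -
    have "(\<integral>z. radial (\<lambda>x. (F x)\<^sup>2 * ln ((F x)\<^sup>2)) z \<partial>ginibre) = (\<integral>r. (F (vec_lambda r))\<^sup>2 * ln ((F (vec_lambda r))\<^sup>2) \<partial>?\<pi>)"
    proof (rule integral_ginibre_radial)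
      show "\<bar>(F x)\<^sup>2 * ln ((F x)\<^sup>2)\<bar> \<le> 1 + (B\<^sup>2)\<^sup>2" for x by (rule abs_mult_ln_bound) (use sq in auto)
    qed (use sym in \<open>auto simp: symmetric_def\<close>)
    then show ?thesis by (simp add: radial_def)
  qed
  have i2: "(\<integral>z. (radial F z)\<^sup>2 \<partial>ginibre) = (\<integral>r. (F (vec_lambda r))\<^sup>2 \<partial>?\<pi>)"
  proof -
    have "(\<integral>z. radial (\<lambda>x. (F x)\<^sup>2) z \<partial>ginibre) = (\<integral>r. (F (vec_lambda r))\<^sup>2 \<partial>?\<pi>)"
      by (rule integral_ginibre_radial[where B="B\<^sup>2"]) (use sym sq in \<open>auto simp: symmetric_def\<close>)
    then show ?thesis by (simp add: radial_def)
  qed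
  obtain C where C: "\<And>x. \<bar>sq_grad x\<bar> \<le> C"
    using bounded_of_support[OF continuous_sq_grad] partial_zero by (auto simp: sq_grad_def)
  have i3: "(\<integral>z. (norm (gradient (radial F) z))\<^sup>2 \<partial>ginibre) = (\<integral>r. sq_grad (vec_lambda r) \<partial>?\<pi>)"
    unfolding norm_gradient_radial
    by (rule integral_ginibre_radial[OF measurable_sq_grad symmetric_sq_grad[OF sym] C])
  show ?thesis
    using lsi_product[of ?N rank_of] unfolding Ent_def energy_def i1 i2 i3 by simp
qed

section \<open>Stability under convergence in the Sobolev norm\<close>

lemma square_integrable_diff:
  fixes v w :: "'a \<Rightarrow> 'b::euclidean_space"
  assumes "square_integrable M v" "square_integrable M w"
  shows "square_integrable M (\<lambda>x. v x - w x)"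
proof -
  have [measurable]: "v \<in> borel_measurable M" "w \<in> borel_measurable M"
    using assms by (auto simp: square_integrable_def)
  have "integrable M (\<lambda>x. (norm (v x - w x))\<^sup>2)"
  proof (rule Bochner_Integration.integrable_bound)
    show "integrable M (\<lambda>x. 2 * (norm (v x))\<^sup>2 + 2 * (norm (w x))\<^sup>2)"
      using assms by (auto simp: square_integrable_def)
    have "(norm (v x - w x))\<^sup>2 \<le> 2 * (norm (v x))\<^sup>2 + 2 * (norm (w x))\<^sup>2" for x
    proof -
      have "(norm (v x - w x))\<^sup>2 \<le> (norm (v x) + norm (w x))\<^sup>2"
        by (intro power_mono norm_triangle_ineq4) simp
      also have "\<dots> \<le> 2 * (norm (v x))\<^sup>2 + 2 * (norm (w x))\<^sup>2"
        using sum_squares_bound[of "norm (v x)" "norm (w x)"] by (simp add: power2_sum)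
      finally show ?thesis .
    qed
    then show "AE x in M. norm ((norm (v x - w x))\<^sup>2) \<le> norm (2 * (norm (v x))\<^sup>2 + 2 * (norm (w x))\<^sup>2)"
      by auto
  qed measurable
  then show ?thesis by (simp add: square_integrable_def)
qed

text \<open>
  The weighted inequality $2 s t \le s^2 / \delta + \delta t^2$; unlike the triangle inequality for the
  $L^2$ norm it can be integrated as it stands.
\<close>

lemma norm_square_perturb:
  fixes a b :: "'b::real_inner"
  assumes "0 < \<delta>"
  shows "\<bar>(norm a)\<^sup>2 - (norm b)\<^sup>2\<bar> \<le> (1 + 1 / \<delta>) * (norm (a - b))\<^sup>2 + \<delta> * (norm b)\<^sup>2"
proof -
  let ?d = "norm (a - b)" and ?b = "norm b"
  have "(norm a)\<^sup>2 - (norm b)\<^sup>2 = ?d\<^sup>2 + 2 * ((a - b) \<bullet> b)"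
    by (simp add: power2_norm_eq_inner inner_diff_left inner_diff_right inner_commute)
  moreover have "\<bar>(a - b) \<bullet> b\<bar> \<le> ?d * ?b" by (rule Cauchy_Schwarz_ineq2)
  moreover have "2 * (?d * ?b) \<le> 1 / \<delta> * ?d\<^sup>2 + \<delta> * ?b\<^sup>2"
  proof -
    have "0 \<le> (?d - \<delta> * ?b)\<^sup>2 / \<delta>" using assms by simp
    also have "\<dots> = 1 / \<delta> * ?d\<^sup>2 + \<delta> * ?b\<^sup>2 - 2 * (?d * ?b)"
      using assms by (simp add: field_simps power2_eq_square)
    finally show ?thesis by simp
  qed
  moreover have "0 \<le> ?d\<^sup>2" by simp
  ultimately show ?thesis unfolding distrib_right mult_1_left by linarith
qed

text \<open>
  Integrate \<open>norm_square_perturb\<close> and choose \<open>\<delta>\<close> small before \<open>k\<close> is chosen large.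
\<close>

lemma L2_norm_tendsto:
  fixes v :: "nat \<Rightarrow> 'a \<Rightarrow> 'b::euclidean_space"
  assumes v: "\<And>k. square_integrable M (v k)" and w: "square_integrable M w"
    and lim: "(\<lambda>k. \<integral>x. (norm (v k x - w x))\<^sup>2 \<partial>M) \<longlonglongrightarrow> 0"
  shows "(\<lambda>k. \<integral>x. (norm (v k x))\<^sup>2 \<partial>M) \<longlonglongrightarrow> (\<integral>x. (norm (w x))\<^sup>2 \<partial>M)"
proof (rule LIMSEQ_I)
  fix e :: real assume e: "0 < e"
  let ?W = "\<integral>x. (norm (w x))\<^sup>2 \<partial>M" and ?a = "\<lambda>k. \<integral>x. (norm (v k x - w x))\<^sup>2 \<partial>M"
  have W: "0 \<le> ?W" by simp
  \<comment> \<open>The summand 1 covers the case \<open>w = 0\<close>.\<close>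
  define \<delta> where "\<delta> = e / (2 * (?W + 1))"
  have \<delta>: "0 < \<delta>" unfolding \<delta>_def
  proof (rule divide_pos_pos[OF e])
    have "0 < 2 * (t + 1)" if "0 \<le> t" for t :: real using that by simp
    from this[OF W] show "0 < 2 * (?W + 1)" .
  qed
  have "e / (2 * (t + 1)) * t \<le> e / 2" if "0 \<le> t" for t
    using e that by (simp add: field_simps)
  from this[OF W] have \<delta>W: "\<delta> * ?W \<le> e / 2" by (simp only: \<delta>_def)
  have "(\<lambda>k. (1 + 1 / \<delta>) * ?a k) \<longlonglongrightarrow> (1 + 1 / \<delta>) * 0" by (intro tendsto_intros lim)
  then have "eventually (\<lambda>k. (1 + 1 / \<delta>) * ?a k < e / 2) sequentially"
    using e by (intro order_tendstoD(2)) auto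
  then obtain K where K: "\<And>k. K \<le> k \<Longrightarrow> (1 + 1 / \<delta>) * ?a k < e / 2"
    by (auto simp: eventually_sequentially)
  have "norm ((\<integral>x. (norm (v k x))\<^sup>2 \<partial>M) - ?W) < e" if "K \<le> k" for k
  proof -
    have iv: "integrable M (\<lambda>x. (norm (v k x))\<^sup>2)" and iw: "integrable M (\<lambda>x. (norm (w x))\<^sup>2)"
      and id: "integrable M (\<lambda>x. (norm (v k x - w x))\<^sup>2)"
      using v w square_integrable_diff[OF v w] by (auto simp: square_integrable_def)
    have "\<bar>(\<integral>x. (norm (v k x))\<^sup>2 \<partial>M) - ?W\<bar> = \<bar>\<integral>x. (norm (v k x))\<^sup>2 - (norm (w x))\<^sup>2 \<partial>M\<bar>"
      using iv iw by simp
    also have "\<dots> \<le> (\<integral>x. \<bar>(norm (v k x))\<^sup>2 - (norm (w x))\<^sup>2\<bar> \<partial>M)" by (rule integral_abs_bound)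
    also have "\<dots> \<le> (\<integral>x. (1 + 1 / \<delta>) * (norm (v k x - w x))\<^sup>2 + \<delta> * (norm (w x))\<^sup>2 \<partial>M)"
      by (rule integral_mono) (use iv iw id norm_square_perturb[OF \<delta>] in auto)
    also have "\<dots> = (1 + 1 / \<delta>) * ?a k + \<delta> * ?W" using iw id by simp
    also have "\<dots> < e" using K[OF that] \<delta>W by linarith
    finally show ?thesis by simp
  qed
  then show "\<exists>K. \<forall>k\<ge>K. norm ((\<integral>x. (norm (v k x))\<^sup>2 \<partial>M) - ?W) < e" by blast
qed

text \<open>
  The entropy is lower semicontinuous along $L^2$ limits: its nonlinear part is treated by Fatou's
  lemma, for which $t \ln t + 1 \ge 0$ is used, and its second part converges.
\<close>

lemma Ent_le_of_L2_limit:
  assumes "prob_space M"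
    and u: "\<And>k. u k \<in> borel_measurable M" "\<And>k. \<exists>B. \<forall>x. \<bar>u k x :: real\<bar> \<le> B"
    and f: "square_integrable M f"
    and L2: "(\<lambda>k. \<integral>x. (u k x - f x)\<^sup>2 \<partial>M) \<longlonglongrightarrow> 0"
    and Ent_le: "\<And>k. Ent M (\<lambda>x. (u k x)\<^sup>2) \<le> E k" and E: "E \<longlonglongrightarrow> e"
  shows "integrable M (\<lambda>x. (f x)\<^sup>2 * ln ((f x)\<^sup>2))" and "Ent M (\<lambda>x. (f x)\<^sup>2) \<le> e"
proof -
  interpret prob_space M by fact
  define \<phi> where "\<phi> t = t * ln t" for t :: real
  note [measurable] = u(1)
  have [measurable]: "f \<in> borel_measurable M" using f by (simp add: square_integrable_def)
  have [measurable]: "\<phi> \<in> borel_measurable borel" unfolding \<phi>_def by measurable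
  have \<phi>_ge: "0 \<le> \<phi> (t\<^sup>2) + 1" for t using mult_ln_ge[of "t\<^sup>2"] by (simp add: \<phi>_def)
  have usq: "square_integrable M (u k)" and u\<phi>: "integrable M (\<lambda>x. \<phi> ((u k x)\<^sup>2))" for k
  proof -
    obtain B where B: "\<And>x. \<bar>u k x\<bar> \<le> B" using u(2)[of k] by auto
    have sq: "(u k x)\<^sup>2 \<le> B\<^sup>2" for x
      using B[of x] by (auto intro: abs_le_square_iff[THEN iffD1])
    show "square_integrable M (u k)"
      unfolding square_integrable_def by (auto intro!: integrable_const_bound[of _ "B\<^sup>2"] simp: sq)
    show "integrable M (\<lambda>x. \<phi> ((u k x)\<^sup>2))"
      by (rule integrable_const_bound[of _ "1 + (B\<^sup>2)\<^sup>2"])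
         (use abs_mult_ln_bound[OF _ sq] in \<open>auto simp: \<phi>_def\<close>)
  qed
  have norms: "(\<lambda>k. \<integral>x. (u k x)\<^sup>2 \<partial>M) \<longlonglongrightarrow> (\<integral>x. (f x)\<^sup>2 \<partial>M)"
    using L2_norm_tendsto[OF usq f] L2 by simp
  have id: "integrable M (\<lambda>x. (u k x - f x)\<^sup>2)" for k
    using square_integrable_diff[OF usq f, of k] by (simp add: square_integrable_def)
  obtain r where r: "strict_mono r" and ae: "AE x in M. (\<lambda>k. (u (r k) x - f x)\<^sup>2) \<longlonglongrightarrow> 0"
    using tendsto_L1_AE_subseq[of M "\<lambda>k x. (u k x - f x)\<^sup>2"] id L2 by auto
  have ae': "AE x in M. (\<lambda>k. \<phi> ((u (r k) x)\<^sup>2) + 1) \<longlonglongrightarrow> \<phi> ((f x)\<^sup>2) + 1"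
    using ae
  proof eventually_elim
    case (elim x)
    have "(\<lambda>k. u (r k) x - f x) \<longlonglongrightarrow> 0"
      using tendsto_real_sqrt[OF elim] by (simp add: tendsto_rabs_zero_iff)
    then have "(\<lambda>k. u (r k) x) \<longlonglongrightarrow> f x" by (simp add: LIM_zero_iff)
    then show ?case unfolding \<phi>_def by (intro tendsto_intros tendsto_mult_ln) auto
  qed
  \<comment> \<open>Upper bounds for the integrals of \<open>\<phi> (u\<^sup>2) + 1\<close>, provided by the inequality for \<open>u\<close>; unlike the
    integrals themselves they are known to converge.\<close>
  let ?b = "\<lambda>k. E (r k) + \<phi> (\<integral>x. (u (r k) x)\<^sup>2 \<partial>M) + 1"
  let ?c = "e + \<phi> (\<integral>x. (f x)\<^sup>2 \<partial>M) + 1"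
  have b_lim: "?b \<longlonglongrightarrow> ?c"
    unfolding \<phi>_def
    by (intro tendsto_intros tendsto_mult_ln LIMSEQ_subseq_LIMSEQ[OF E r, unfolded o_def]
        LIMSEQ_subseq_LIMSEQ[OF norms r, unfolded o_def]) auto
  have b_ge: "(\<integral>x. \<phi> ((u (r k) x)\<^sup>2) + 1 \<partial>M) \<le> ?b k" for k
    using Ent_le[of "r k"] u\<phi>[of "r k"] prob_space by (simp add: Ent_def \<phi>_def)
  have b_nonneg: "0 \<le> ?b k" for k
    by (rule order_trans[OF _ b_ge]) (use \<phi>_ge in simp)
  have c_nonneg: "0 \<le> ?c"
    by (rule LIMSEQ_le_const[OF b_lim]) (use b_nonneg in auto)
  have "(\<integral>\<^sup>+x. ennreal (\<phi> ((f x)\<^sup>2) + 1) \<partial>M) = (\<integral>\<^sup>+x. liminf (\<lambda>k. ennreal (\<phi> ((u (r k) x)\<^sup>2) + 1)) \<partial>M)"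
  proof (rule nn_integral_cong_AE)
    show "AE x in M. ennreal (\<phi> ((f x)\<^sup>2) + 1) = liminf (\<lambda>k. ennreal (\<phi> ((u (r k) x)\<^sup>2) + 1))"
      using ae'
    proof eventually_elim
      case (elim x)
      then have "(\<lambda>k. ennreal (\<phi> ((u (r k) x)\<^sup>2) + 1)) \<longlonglongrightarrow> ennreal (\<phi> ((f x)\<^sup>2) + 1)" by (rule tendsto_ennrealI)
      then show ?case by (rule lim_imp_Liminf[OF sequentially_bot, symmetric])
    qed
  qed
  also have "\<dots> \<le> liminf (\<lambda>k. \<integral>\<^sup>+x. ennreal (\<phi> ((u (r k) x)\<^sup>2) + 1) \<partial>M)"
    by (rule nn_integral_liminf) measurable
  also have "\<dots> \<le> liminf (\<lambda>k. ennreal (?b k))"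
  proof (rule Liminf_mono, rule always_eventually, rule allI)
    fix k
    have "(\<integral>\<^sup>+x. ennreal (\<phi> ((u (r k) x)\<^sup>2) + 1) \<partial>M) = ennreal (\<integral>x. \<phi> ((u (r k) x)\<^sup>2) + 1 \<partial>M)"
      by (rule nn_integral_eq_integral) (use u\<phi> \<phi>_ge in auto)
    then show "(\<integral>\<^sup>+x. ennreal (\<phi> ((u (r k) x)\<^sup>2) + 1) \<partial>M) \<le> ennreal (?b k)"
      using b_ge[of k] by (simp add: ennreal_leI)
  qed
  also have "\<dots> = ennreal ?c"
    by (rule lim_imp_Liminf[OF sequentially_bot tendsto_ennrealI[OF b_lim]])
  finally have bound: "(\<integral>\<^sup>+x. ennreal (\<phi> ((f x)\<^sup>2) + 1) \<partial>M) \<le> ennreal ?c" .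
  have int1: "integrable M (\<lambda>x. \<phi> ((f x)\<^sup>2) + 1)"
    by (rule integrableI_nonneg) (use bound \<phi>_ge in \<open>auto simp: less_top[symmetric] top_unique\<close>)
  then have int: "integrable M (\<lambda>x. \<phi> ((f x)\<^sup>2))"
    using Bochner_Integration.integrable_diff[OF int1, of "\<lambda>_. 1"] by simp
  then show "integrable M (\<lambda>x. (f x)\<^sup>2 * ln ((f x)\<^sup>2))" by (simp add: \<phi>_def)
  have "ennreal (\<integral>x. \<phi> ((f x)\<^sup>2) + 1 \<partial>M) \<le> ennreal ?c"
    using bound nn_integral_eq_integral[OF int1] \<phi>_ge by simp
  then have "(\<integral>x. \<phi> ((f x)\<^sup>2) + 1 \<partial>M) \<le> ?c" using c_nonneg by simp
  then show "Ent M (\<lambda>x. (f x)\<^sup>2) \<le> e"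
    using int prob_space by (simp add: Ent_def \<phi>_def)
qed

lemma H1_tendstoD:
  assumes "H1_tendsto u f g"
  shows "(\<lambda>k. \<integral>z. (u k z - f z)\<^sup>2 \<partial>ginibre) \<longlonglongrightarrow> 0"
    and "(\<lambda>k. \<integral>z. (norm (gradient (u k) z - g z))\<^sup>2 \<partial>ginibre) \<longlonglongrightarrow> 0"
proof -
  let ?a = "\<lambda>k. \<integral>z. (u k z - f z)\<^sup>2 \<partial>ginibre" and ?b = "\<lambda>k. \<integral>z. (norm (gradient (u k) z - g z))\<^sup>2 \<partial>ginibre"
  have "(\<lambda>k. (sqrt (?a k + ?b k))\<^sup>2) \<longlonglongrightarrow> 0\<^sup>2"
    using assms unfolding H1_tendsto_def H1_norm_def by (rule tendsto_power)
  then have s: "(\<lambda>k. ?a k + ?b k) \<longlonglongrightarrow> 0" by simp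
  show "?a \<longlonglongrightarrow> 0"
    by (rule tendsto_sandwich[OF _ _ tendsto_const s]) (auto intro!: always_eventually)
  show "?b \<longlonglongrightarrow> 0"
    by (rule tendsto_sandwich[OF _ _ tendsto_const s]) (auto intro!: always_eventually)
qed

lemma Ent_ginibre_closure_le:
  fixes f :: "'n::{finite,linorder} cspace \<Rightarrow> real"
  assumes "(f, g) \<in> H1_closure symmetric_radial"
  shows "integrable ginibre (\<lambda>z. (f z)\<^sup>2 * ln ((f z)\<^sup>2))" and "Ent ginibre (\<lambda>z. (f z)\<^sup>2) \<le> energy g"
proof -
  obtain u where f: "square_integrable ginibre f" and g: "square_integrable ginibre g"
    and u: "\<And>k. u k \<in> symmetric_radial" and lim: "H1_tendsto u f g"
    using assms by (auto simp: H1_closure_def H1_def)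
  interpret P: prob_space "ginibre :: 'n cspace measure" by (rule prob_space_ginibre)
  have props: "u k \<in> borel_measurable ginibre \<and> (\<exists>B. \<forall>z. \<bar>u k z\<bar> \<le> B) \<and> square_integrable ginibre (gradient (u k)) \<and>
      Ent ginibre (\<lambda>z. (u k z)\<^sup>2) \<le> energy (gradient (u k))" for k
  proof -
    obtain F where hF: "F \<in> Cc_infty {x. \<forall>i. 0 < x $ i}" "symmetric F" and uk: "u k = radial F"
      using u[of k] by (auto simp: symmetric_radial_def)
    interpret positive_test_function F by standard (rule hF(1))
    obtain B where B: "\<And>x. \<bar>F x\<bar> \<le> B" using bounded_F_partial by auto
    obtain C where C: "\<And>x. \<bar>sq_grad x\<bar> \<le> C"
      using bounded_of_support[OF continuous_sq_grad] partial_zero by (auto simp: sq_grad_def)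
    have r: "(\<lambda>z :: 'n cspace. \<chi> i. cmod (z $ i)) \<in> borel_measurable borel"
      by (intro borel_measurable_continuous_onI continuous_intros)
    have "radial F \<in> borel_measurable ginibre"
      using measurable_compose[OF r measurable_F] by (simp add: radial_def[abs_def])
    moreover have "\<forall>z. \<bar>radial F z\<bar> \<le> B" using B by (simp add: radial_def)
    moreover have "square_integrable ginibre (gradient (radial F))"
      unfolding square_integrable_def
    proof
      show m: "gradient (radial F) \<in> borel_measurable ginibre"
        using measurable_gradient_radial by simp
      show "integrable ginibre (\<lambda>z. (norm (gradient (radial F) z))\<^sup>2)"
      proof (rule P.integrable_const_bound[of _ C])
        show "AE z in ginibre. norm ((norm (gradient (radial F) z))\<^sup>2) \<le> C"
          unfolding norm_gradient_radial using C by (simp add: radial_def)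
        show "(\<lambda>z. (norm (gradient (radial F) z))\<^sup>2) \<in> borel_measurable ginibre"
          by (intro borel_measurable_power measurable_compose[OF m borel_measurable_norm])
      qed
    qed
    moreover have "Ent ginibre (\<lambda>z. (radial F z)\<^sup>2) \<le> energy (gradient (radial F))"
      by (rule Ent_ginibre_radial_le[OF _ hF(2)]) (rule positive_test_function_axioms)
    ultimately show ?thesis unfolding uk by blast
  qed
  note L = H1_tendstoD[OF lim]
  have E: "(\<lambda>k. energy (gradient (u k))) \<longlonglongrightarrow> energy g"
    unfolding energy_def by (intro tendsto_mult tendsto_const L2_norm_tendsto[OF _ g L(2)]) (use props in blast)
  show "integrable ginibre (\<lambda>z. (f z)\<^sup>2 * ln ((f z)\<^sup>2))" "Ent ginibre (\<lambda>z. (f z)\<^sup>2) \<le> energy g"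
    using Ent_le_of_L2_limit[OF prob_space_ginibre _ _ f L(1) _ E] props by blast+
qed

theorem theorem1p12:
  shows "(\<forall>F :: real ^ 'n::{finite,linorder} \<Rightarrow> real.
            F \<in> Cc_infty {x. \<forall>i. 0 < x $ i} \<longrightarrow> symmetric F \<longrightarrow>
            Ent ginibre (\<lambda>z. (radial F z)\<^sup>2) \<le> energy (gradient (radial F))) \<and>
         (\<forall>(f :: 'n cspace \<Rightarrow> real) g.
            (f, g) \<in> H1_closure symmetric_radial \<longrightarrow>
            integrable ginibre (\<lambda>z. (f z)\<^sup>2 * ln ((f z)\<^sup>2)) \<and>
            Ent ginibre (\<lambda>z. (f z)\<^sup>2) \<le> energy g)"
  using Ent_ginibre_radial_le positive_test_function.intro Ent_ginibre_closure_le by blast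

end
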